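(* Let $p$ be an odd prime, let $m,\alpha$ be positive integers, and put $e=2m$, $q=p^{e}$, $d=\gcd(\alpha,e)$. Suppose that $\frac{m}{d}$ is even, and let $c\in\mathbb{F}_p$ with $c\neq 0$. Let $D=\{x\in\mathbb{F}_q^{*}: Tr(x^{p^{\alpha}+1})=0\}=\{d_1,\dots,d_n\}$ and let $$\mathcal{C}_D=\{(Tr(xd_1)+c,Tr(xd_2)+c,\dots,Tr(xd_n)+c): x\in\mathbb{F}_q\}.$$ Then $\mathcal{C}_D$ is a $[p^{e-1}-(p-1)p^{m+d-1}-1,\;e+1]$ linear code over $\mathbb{F}_p$ whose weight distribution is: - weight $(p-1)(p^{e-2}-(p-1)p^{m+d-2})-1$ with multiplicity $p^{e}-p^{e-2d}$; - weight $(p-1)(p^{e-2}-p^{m+d-1})-1$ with multiplicity $p^{e-2d-1}-(p-1)p^{m-d-1}-1$; - weight $(p-1)p^{e-2}-(p-2)p^{m+d-1}-1$ with multiplicity $(p-1)(p^{e-2d-1}+p^{m-d-1})$; - weight $p^{e-1}-(p-1)p^{m+d-1}-1$ with multiplicity $1$; and whose complete weight enumerator is $$\begin{aligned}\mathit{CWE}(\mathcal{C}_{D})={}&w_{c}^{p^{e-1}-(p-1)p^{m+d-1}-1}+(p^{e}-p^{e-2d})\,w_{c}^{p^{e-2}-(p-1)p^{m+d-2}-1}\prod_{\substack{0\le i\le p-1\\ i\ne c}}w_{i}^{p^{e-2}-(p-1)p^{m+d-2}}\\ &+\bigl(p^{e-2d-1}-(p-1)p^{m-d-1}-1\bigr)\,w_{c}^{p^{e-2}-(p-1)p^{m+d-1}-1}\prod_{\substack{0\le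 i\le p-1\\ i\ne c}}w_{i}^{p^{e-2}}\\ &+(p-1)\bigl(p^{e-2d-1}+p^{m-d-1}\bigr)\,w_{c}^{p^{e-2}-1}\prod_{\substack{0\le i\le p-1\\ i\ne c}}w_{i}^{p^{e-2}-p^{m+d-1}}.\end{aligned}$$
   Context: $Tr$ denotes the trace function from $\mathbb{F}_q$ to $\mathbb{F}_p$. An $[n,k]$ linear code over $\mathbb{F}_p$ is a $k$-dimensional subspace of $\mathbb{F}_p^{n}$. Elements of $\mathbb{F}_p$ are identified with $0,1,\dots,p-1$. For a codeword $\mathbf{c}\in\mathbb{F}_p^{n}$, its complete weight enumerator is the monomial $w(\mathbf{c})=w_0^{t_0}w_1^{t_1}\cdots w_{p-1}^{t_{p-1}}$ in the unknowns $w_0,\dots,w_{p-1}$, where $t_i$ is the number of components of $\mathbf{c}$ equal to $i$; the complete weight enumerator of a code $\mathcal{C}$ is $\mathit{CWE}(\mathcal{C})=\sum_{\mathbf{c}\in\mathcal{C}}w(\mathbf{c})$. The weight distribution gives, for each Hamming weight, the number (multiplicity) of codewords having that weight.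
   Formalization: C_D with fixed c≠0 is only a coset (it omits 0), so "[n, e+1] linear code" is proved for the code it spans; the case m=2, d=1, where C_D has just p^2 words and the claimed weights clash, is excluded except for the length formula. *)

theory Defs
  imports
    "Berlekamp_Zassenhaus.Finite_Field"
    "Jordan_Normal_Form.VS_Connect"
    "HOL-Library.Poly_Mapping"
begin

text \<open>
  The prime field of order $p$ is \<^typ>\<open>'p mod_ring\<close> with \<open>p = CARD('p)\<close> (the class
  \<^class>\<open>prime_card\<close> says that this number is prime); the elements of this type are the residues
  $0, \ldots, p - 1$.  The field of order $q = p^e$ is any finite field type \<open>'a\<close> with
  \<open>CARD('a) = p ^ e\<close>.
\<close>

text \<open>
  The trace of \<open>x\<close> is $x + x^p + \cdots + x^{p^{e-1}}$. This is an element of the prime subfield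
  of \<open>'a\<close>, into which \<^typ>\<open>'p mod_ring\<close> is embedded by \<open>t \<mapsto> of_int (to_int_mod_ring t)\<close>.
\<close>

definition field_trace :: "nat \<Rightarrow> 'a::{field,finite} \<Rightarrow> 'p::prime_card mod_ring" where
  "field_trace e x =
     (THE t :: 'p mod_ring. of_int (to_int_mod_ring t) = (\<Sum>i<e. x ^ (CARD('p) ^ i)))"

definition linear_code :: "nat \<Rightarrow> nat \<Rightarrow> 'f::field vec set \<Rightarrow> bool" where
  "linear_code n k C \<longleftrightarrow>
     subspace class_ring C (module_vec TYPE('f) n) \<and>
     vectorspace.dim class_ring (module_vec TYPE('f) n \<lparr>carrier := C\<rparr>) = k"

text \<open>
  The smallest linear code containing \<open>S\<close>. A set of words $(Tr(x d_1) + c, \ldots, Tr(x d_n) + c)$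
  with fixed $c \neq 0$ is in general only a coset of a subspace, so that linearity and dimension have to
  be read as statements about the code it generates.
\<close>

definition generated_code :: "nat \<Rightarrow> 'f::field vec set \<Rightarrow> 'f vec set" where
  "generated_code n S = LinearCombinations.module.span class_ring (module_vec TYPE('f) n) S"

definition hamming_weight :: "'f::zero vec \<Rightarrow> nat" where
  "hamming_weight v = card {j. j < dim_vec v \<and> v $ j \<noteq> 0}"

definition weight_multiplicity :: "'f::zero vec set \<Rightarrow> nat \<Rightarrow> nat" where
  "weight_multiplicity C h = card {v \<in> C. hamming_weight v = h}"

text \<open>
  Polynomials with integer coefficients in unknowns $w_i$ indexed by the elements \<open>i\<close> of the
  alphabet: finitely supported maps from monomials to coefficients, a monomial being a finitely
  supported map from unknowns to exponents.
\<close>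

type_synonym 'f enumerator = "('f \<Rightarrow>\<^sub>0 nat) \<Rightarrow>\<^sub>0 int"

definition unknown :: "'f \<Rightarrow> 'f enumerator" where
  "unknown i = Poly_Mapping.single (Poly_Mapping.single i 1) 1"

definition cwe_monomial :: "'f::finite vec \<Rightarrow> 'f enumerator" where
  "cwe_monomial v = (\<Prod>i\<in>UNIV. unknown i ^ card {j. j < dim_vec v \<and> v $ j = i})"

definition CWE :: "'f::finite vec set \<Rightarrow> 'f enumerator" where
  "CWE C = (\<Sum>v\<in>C. cwe_monomial v)"

end

theory Submission
  imports Defs "HOL-Number_Theory.Residues"
begin

text \<open>
  Let $Q(x) = Tr(x^{p^\alpha+1})$, a quadratic form over the prime field with polar form
  $B(x, y) = Tr(y L(x))$. The radical $R = \ker L$ consists of the solutions of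
  $x^{p^{2\alpha}} = -x$ and has $p^{2d}$ elements. Counting the pairs with $Q(x) = Q(y)$, which
  correspond to the pairs with $B(u, v) = 0$, determines the number $N_1$ of solutions of
  $Q(x) = 1$ up to a sign, and the sign follows from $p^d + 1 \mid N_1$. No exponential sums are
  needed.

  The number of $y$ with $Q(y) = 0$ and $Tr(xy) = s$ depends on the position of $x$: for
  $x \notin L(F_q) = R^\perp$ translations by $R$ make it independent of $s$, for $x = L(a)$ with
  $Q(a) = 0$ translations by multiples of $a$ do the work, and for $x = L(a)$ with
  $Q(a) \neq 0$ one splits off the line spanned by $a$. The multiplicities are the sizes of the
  three classes, and every $x \neq 0$ attains every nonzero value $s$, which gives injectivity and
  the dimension.
\<close>

section \<open>Counting by fibers\<close>

text \<open>The evenness of \<open>m div d\<close> is used in base \<open>b = p ^ d\<close>: the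
  field has \<open>b ^ (4 * k)\<close> elements and \<open>p ^ \<alpha> = b ^ a\<close> with
  \<open>a\<close> odd. The factor 4 makes \<open>2 * (b^2 - 1)\<close> divide the order of the
  multiplicative group, so that \<open>y ^ (b^2) = - y\<close> has a nonzero solution and the
  radical is not zero. Oddness of \<open>a\<close> makes the \<open>p ^ \<alpha>\<close> power act
  on the subfield of order \<open>b^2\<close> as the \<open>b\<close>-th power; norms from that
  subfield supply both the scalings of \<open>Q\<close> and the symmetries behind the divisibility
  of \<open>N1\<close>.

  The pair \<open>m = 2\<close>, \<open>d = 1\<close> is a genuine exception for everything but the
  length. There \<open>N0 = p^2 = card R\<close>, so the zeros of \<open>Q\<close> are exactly
  \<open>R\<close>, and the words of \<open>x\<close> and \<open>x + L u\<close> coincide: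
  injectivity fails and the generated code has dimension at most 3 instead of 5. The entry counts
  stay true in this case; what breaks is their separation, since the smallest one,
  \<open>p ^ (e - 2) - p ^ (m + d - 1)\<close>, becomes 0. In all other cases it is
  positive.\<close>

lemma card_eq_sum_fibers:
  fixes f :: "'b \<Rightarrow> 'f::finite"
  assumes "finite S"
  shows "card S = (\<Sum>t\<in>UNIV. card {x \<in> S. f x = t})"
proof -
  have "(\<Sum>t\<in>UNIV. \<Sum>x\<in>{x \<in> S. f x = t}. 1) = (\<Sum>x\<in>S. 1::nat)"
    by (rule sum.group) (use assms in auto)
  thus ?thesis by simp
qed

lemma card_pairs:
  assumes "finite A" "\<And>x. x \<in> A \<Longrightarrow> finite {y. Pr x y}"
  shows "card {(x, y). x \<in> A \<and> Pr x y} = (\<Sum>x\<in>A. card {y. Pr x y})"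
proof -
  have "{(x, y). x \<in> A \<and> Pr x y} = (SIGMA x:A. {y. Pr x y})" by auto
  thus ?thesis using assms by (simp add: card_SigmaI)
qed

text \<open>Translation by \<open>h (u - t)\<close> injects the fiber over \<open>t\<close> into the
  fiber over \<open>u\<close>, and this in both directions, so \<open>h\<close> need not be
  additive. Later \<open>S\<close> is the whole field, a subspace, the zero set of \<open>Q\<close>,
  or an affine hyperplane.\<close>

lemma card_fiber_of_translations:
  fixes f :: "'b::group_add \<Rightarrow> 'f::{finite,ab_group_add}" and h :: "'f \<Rightarrow> 'b"
  assumes S: "finite S" and cl: "\<And>x s. x \<in> S \<Longrightarrow> x + h s \<in> S"
    and f: "\<And>x s. x \<in> S \<Longrightarrow> f (x + h s) = f x + s"
  shows "CARD('f) * card {x \<in> S. f x = t} = card S"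
proof -
  have le: "card {x \<in> S. f x = t} \<le> card {x \<in> S. f x = u}" for t u
  proof (rule card_inj_on_le)
    show "inj_on (\<lambda>x. x + h (u - t)) {x \<in> S. f x = t}" by (auto simp: inj_on_def)
    show "(\<lambda>x. x + h (u - t)) ` {x \<in> S. f x = t} \<subseteq> {x \<in> S. f x = u}"
      using cl f by auto
    show "finite {x \<in> S. f x = u}" using S by simp
  qed
  have "card S = (\<Sum>u\<in>(UNIV::'f set). card {x \<in> S. f x = u})"
    by (rule card_eq_sum_fibers[OF S])
  also have "\<dots> = (\<Sum>u\<in>(UNIV::'f set). card {x \<in> S. f x = t})"
    by (rule sum.cong[OF refl]) (use le in \<open>simp add: order_antisym\<close>)
  finally show ?thesis by simp
qed

section \<open>Quadratic forms given by a trace\<close>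

text \<open>The counting needs no formula for \<open>Q\<close> or \<open>L\<close>, only that
  \<open>L\<close> represents the polar form under the trace pairing. \<open>Q_similar\<close> makes
  every nonzero scalar a similitude factor; hence all nonzero values of \<open>Q\<close> are equally
  frequent and the two unknowns \<open>N0\<close> and \<open>N1\<close> describe the whole
  distribution.\<close>

locale trace_quadratic_form =
  fixes emb :: "'f::{field,finite} \<Rightarrow> 'a::{field,finite}"
    and T :: "'a \<Rightarrow> 'f" and L :: "'a \<Rightarrow> 'a" and Q :: "'a \<Rightarrow> 'f"
  assumes emb_add: "emb (s + t) = emb s + emb t"
    and emb_mult: "emb (s * t) = emb s * emb t"
    and emb_1: "emb 1 = 1"
    and two: "(2::'f) \<noteq> 0"
    and T_add: "T (x + y) = T x + T y"
    and T_scale: "T (emb s * x) = s * T x"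
    and T_nonzero: "\<exists>x. T x \<noteq> 0"
    and L_add: "L (x + y) = L x + L y"
    and Q_add: "Q (x + y) = Q x + Q y + T (y * L x)"
    and Q_scale: "Q (emb s * x) = s^2 * Q x"
    and Q_similar: "t \<noteq> 0 \<Longrightarrow> \<exists>z. z \<noteq> 0 \<and> (\<forall>x. Q (z * x) = t * Q x)"
begin

definition B :: "'a \<Rightarrow> 'a \<Rightarrow> 'f" where "B x y = T (y * L x)"

definition R :: "'a set" where "R = {x. L x = 0}"

definition N0 :: nat where "N0 = card {x. Q x = 0}"

definition N1 :: nat where "N1 = card {x. Q x = 1}"

section \<open>The polar form and its radical\<close>

lemma emb_0 [simp]: "emb 0 = 0"
  using emb_add[of 0 0] by (metis add_0 add_right_cancel)

lemma emb_nonzero: "s \<noteq> 0 \<Longrightarrow> emb s \<noteq> 0"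
  using emb_mult[of s "inverse s"] emb_1 by auto

lemma emb_minus_1: "emb (-1) = -1"
  using emb_add[of 1 "-1"] emb_1 by (simp add: add_eq_0_iff)

lemma two_neq_0: "(2::'a) \<noteq> 0"
  using emb_nonzero[OF two] emb_add[of 1 1] emb_1 by simp

lemma T_0 [simp]: "T 0 = 0"
  using T_add[of 0 0] by (metis add_0 add_right_cancel)

lemma L_0 [simp]: "L 0 = 0"
  using L_add[of 0 0] by (metis add_0 add_right_cancel)

lemma L_minus: "L (- x) = - L x"
  using L_add[of x "-x"] by (simp add: add_eq_0_iff2)

lemma Q_0 [simp]: "Q 0 = 0"
  using Q_scale[of 0 0] by simp

lemma Q_minus: "Q (- x) = Q x"
  using Q_scale[of "-1" x] emb_minus_1 by simp

lemma Q_add': "Q (x + y) = Q x + Q y + B x y"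
  by (simp add: Q_add B_def)

lemma B_commute: "B x y = B y x"
  using Q_add'[of x y] Q_add'[of y x] by (simp add: add.commute)

lemma B_add_right: "B x (y + z) = B x y + B x z"
  by (simp add: B_def T_add distrib_right)

lemma B_scale_right: "B x (emb s * y) = s * B x y"
  by (simp add: B_def T_scale mult.assoc)

lemma B_minus_right: "B x (- y) = - B x y"
  using B_scale_right[of x "-1" y] emb_minus_1 by simp

lemma B_scale_left: "B (emb s * x) y = s * B x y"
  by (metis B_commute B_scale_right)

text \<open>\<open>Q (x + x)\<close> is \<open>4 * Q x\<close> by homogeneity and
  \<open>2 * Q x + B x x\<close> by the polar identity.\<close>

lemma B_self: "B x x = 2 * Q x"
proof -
  have "emb 2 * x = x + x" using emb_add[of 1 1] emb_1 by (simp add: distrib_right)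
  moreover have "(2::'f)\<^sup>2 = 4" by simp
  ultimately have "4 * Q x = Q (x + x)" using Q_scale[of 2 x] by metis
  also have "\<dots> = 2 * Q x + B x x" by (simp only: Q_add' mult_2)
  finally have "B x x = 4 * Q x - 2 * Q x" by (simp only: add_diff_cancel_left')
  thus ?thesis by (simp add: Q_add')
qed

text \<open>Nondegeneracy of the trace pairing: an element outside the kernel of \<open>T\<close> is
  normalized by a scalar and divided by \<open>c\<close>.\<close>

lemma obtain_T_mult:
  assumes "c \<noteq> 0"
  obtains w where "T (c * w) = 1"
proof -
  obtain x where x: "T x \<noteq> 0" using T_nonzero by auto
  have "T (c * (emb (inverse (T x)) * (x / c))) = 1"
    using assms x T_scale[of "inverse (T x)" x] by (simp add: field_simps)
  thus ?thesis using that by blast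
qed

lemma R_iff_B: "x \<in> R \<longleftrightarrow> (\<forall>y. B x y = 0)"
proof
  assume "\<forall>y. B x y = 0"
  hence "T (L x * y) = 0" for y by (simp add: B_def mult.commute)
  thus "x \<in> R" unfolding R_def using obtain_T_mult[of "L x"] by fastforce
qed (simp add: R_def B_def)

lemma R_B: "r \<in> R \<Longrightarrow> B r y = 0" "r \<in> R \<Longrightarrow> B y r = 0"
  by (simp add: R_def B_def, subst B_commute, simp add: R_def B_def)

lemma R_0: "0 \<in> R" by (simp add: R_def)

lemma R_scale: "r \<in> R \<Longrightarrow> emb s * r \<in> R"
  by (simp add: R_iff_B B_scale_left)

lemma R_add: "r \<in> R \<Longrightarrow> r' \<in> R \<Longrightarrow> r + r' \<in> R"
  by (simp add: R_def L_add)

lemma Q_R: "r \<in> R \<Longrightarrow> Q r = 0"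
  using B_self[of r] R_B[of r r] two by simp

lemma Q_add_R: "r \<in> R \<Longrightarrow> Q (x + r) = Q x"
  by (simp add: Q_add' Q_R R_B)

lemma Q_line: "Q (x + emb s * a) = Q x + s^2 * Q a + s * B a x"
  by (simp add: Q_add' Q_scale B_scale_right B_commute)

lemma P_gt_1: "CARD('f) > 1"
  using card_mono[of UNIV "{0, 1 :: 'f}"] by simp

section \<open>Value distribution of the form, up to a sign\<close>

lemma card_T_fiber:
  assumes "c \<noteq> 0"
  shows "CARD('f) * card {y. T (c * y) = s} = CARD('a)"
proof -
  obtain w where w: "T (c * w) = 1" using obtain_T_mult[OF assms] .
  have "CARD('f) * card {y \<in> UNIV. T (c * y) = s} = card (UNIV :: 'a set)"
  proof (rule card_fiber_of_translations[where h = "\<lambda>s. emb s * w"])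
    fix x s
    have "T (c * (emb s * w)) = s * T (c * w)"
      using T_scale[of s "c * w"] by (simp add: mult.left_commute)
    thus "T (c * (x + emb s * w)) = T (c * x) + s"
      by (simp add: distrib_left T_add w)
  qed auto
  thus ?thesis by simp
qed

lemma card_B_fiber:
  assumes "a \<notin> R"
  shows "CARD('f) * card {y. B a y = s} = CARD('a)"
  using card_T_fiber[of "L a" s] assms by (simp add: R_def B_def mult.commute)

lemma card_Q_nonzero:
  assumes "t \<noteq> 0"
  shows "card {x. Q x = t} = N1"
proof -
  obtain z where z: "z \<noteq> 0" "\<And>x. Q (z * x) = t * Q x" using Q_similar[OF assms] by auto
  have "Q (x / z) = 1" if "Q x = t" for x
    using z(2)[of "x / z"] z(1) that assms by simp
  hence "bij_betw (\<lambda>x. z * x) {x. Q x = 1} {x. Q x = t}"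
    by (intro bij_betw_byWitness[where f' = "\<lambda>x. x / z"]) (use z in auto)
  thus ?thesis unfolding N1_def by (simp add: bij_betw_same_card)
qed

lemma N0_N1: "N0 + (CARD('f) - 1) * N1 = CARD('a)"
proof -
  have "CARD('a) = (\<Sum>t\<in>(UNIV::'f set). card {x \<in> (UNIV :: 'a set). Q x = t})"
    by (rule card_eq_sum_fibers) simp
  also have "\<dots> = N0 + (\<Sum>t\<in>(UNIV - {0}::'f set). N1)"
    by (subst sum.remove[of _ 0]) (auto simp: N0_def card_Q_nonzero intro!: sum.cong)
  also have "(\<Sum>t\<in>(UNIV - {0}::'f set). N1) = (CARD('f) - 1) * N1"
    by (simp add: card_Diff_subset)
  finally show ?thesis by (rule sym)
qed

text \<open>For \<open>a\<close> in the radical every \<open>b\<close> qualifies; any other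
  \<open>a\<close> leaves a hyperplane. The factor \<open>CARD('f)\<close> clears the denominator of
  the hyperplane size.\<close>

lemma card_pairs_B: "CARD('f) * card {(a, b). B a b = 0} = CARD('f) * card R * CARD('a) + (CARD('a) - card R) * CARD('a)"
proof -
  have "card {(a, b). a \<in> UNIV \<and> B a b = 0} = (\<Sum>a\<in>UNIV. card {b. B a b = 0})"
    by (rule card_pairs) auto
  hence "CARD('f) * card {(a, b). B a b = 0} = (\<Sum>a\<in>UNIV. CARD('f) * card {b. B a b = 0})"
    by (simp add: sum_distrib_left)
  also have "\<dots> = (\<Sum>a\<in>R. CARD('f) * card {b. B a b = 0}) + (\<Sum>a\<in>UNIV - R. CARD('f) * card {b. B a b = 0})"
    by (simp add: sum.subset_diff[of R UNIV] add.commute)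
  also have "(\<Sum>a\<in>R. CARD('f) * card {b. B a b = 0}) = (\<Sum>a\<in>R. CARD('f) * CARD('a))"
    by (rule sum.cong) (auto simp: R_B)
  also have "(\<Sum>a\<in>UNIV - R. CARD('f) * card {b. B a b = 0}) = (\<Sum>a\<in>UNIV - R. CARD('a))"
    by (rule sum.cong) (auto simp: card_B_fiber)
  finally show ?thesis by (simp add: card_Diff_subset)
qed

text \<open>The substitution $x = a + b$, $y = a - b$ turns $Q(x) - Q(y)$ into $2 B(a, b)$.\<close>

lemma halves: "(a + b + (a - b)) / 2 = (a::'a)" "(a + b - (a - b)) / 2 = b"
  "(a + b) / 2 + (a - b) / 2 = a" "(a + b) / 2 - (a - b) / 2 = b"
proof -
  have "(2 * a) / 2 = a" "(2 * b) / 2 = b" using two_neq_0 by (metis nonzero_mult_div_cancel_left)+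
  moreover have "a + b + (a - b) = 2 * a" "a + b - (a - b) = 2 * b" by simp_all
  ultimately show "(a + b + (a - b)) / 2 = a" "(a + b - (a - b)) / 2 = b"
    "(a + b) / 2 + (a - b) / 2 = a" "(a + b) / 2 - (a - b) / 2 = b"
    by (simp_all flip: add_divide_distrib diff_divide_distrib)
qed

lemma card_pairs_Q: "card {(a, b). B a b = 0} = N0^2 + (CARD('f) - 1) * N1^2"
proof -
  have "bij_betw (\<lambda>(a, b). (a + b, a - b)) {(a, b). B a b = 0} {(x, y). Q x = Q y}"
  proof (rule bij_betw_byWitness[where f' = "\<lambda>(x, y). ((x + y) / 2, (x - y) / 2)"])
    have Q: "Q (a + b) = Q (a - b) \<longleftrightarrow> B a b = 0" for a b
    proof -
      have "Q (a + b) - Q (a - b) = 2 * B a b"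
        using Q_add'[of a b] Q_add'[of a "-b"] by (simp add: Q_minus B_minus_right)
      thus ?thesis using two by (metis eq_iff_diff_eq_0 mult_eq_0_iff)
    qed
    show "(\<lambda>(a, b). (a + b, a - b)) ` {(a, b). B a b = 0} \<subseteq> {(x, y). Q x = Q y}"
      using Q by auto
    show "(\<lambda>(x, y). ((x + y) / 2, (x - y) / 2)) ` {(x, y). Q x = Q y} \<subseteq> {(a, b). B a b = 0}"
    proof safe
      fix x y assume "Q x = Q y"
      moreover have "(x + y) / 2 + (x - y) / 2 = x" "(x + y) / 2 - (x - y) / 2 = y"
        by (rule halves)+
      ultimately show "B ((x + y) / 2) ((x - y) / 2) = 0" by (simp flip: Q)
    qed
  qed (use halves in auto)
  hence "card {(a, b). B a b = 0} = card {(x, y). x \<in> UNIV \<and> Q x = Q y}"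
    by (simp add: bij_betw_same_card)
  also have "\<dots> = card {(x, y). x \<in> UNIV \<and> Q y = Q x}"
    by (rule arg_cong[where f = card]) auto
  also have "\<dots> = (\<Sum>x\<in>UNIV. card {y. Q y = Q x})"
    by (rule card_pairs) auto
  also have "\<dots> = (\<Sum>x\<in>{x. Q x = 0}. card {y. Q y = Q x}) + (\<Sum>x\<in>UNIV - {x. Q x = 0}. card {y. Q y = Q x})"
    by (simp add: sum.subset_diff[of "{x. Q x = 0}" UNIV] add.commute)
  also have "(\<Sum>x\<in>{x. Q x = 0}. card {y. Q y = Q x}) = (\<Sum>x\<in>{x. Q x = 0}. N0)"
    by (rule sum.cong) (auto simp: N0_def)
  also have "(\<Sum>x\<in>UNIV - {x. Q x = 0}. card {y. Q y = Q x}) = (\<Sum>x\<in>UNIV - {x. Q x = 0}. N1)"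
    by (rule sum.cong) (auto simp: card_Q_nonzero)
  also have "(\<Sum>x\<in>UNIV - {x. Q x = 0}. N1) = (CARD('a) - N0) * N1"
    by (simp add: card_Diff_subset N0_def)
  also have "CARD('a) - N0 = (CARD('f) - 1) * N1" using N0_N1 by simp
  finally show ?thesis by (simp add: N0_def power2_eq_square)
qed

text \<open>Because all nonzero values are equally frequent, \<open>N0 - N1\<close> is what the
  exponential sum of \<open>Q\<close> would evaluate to. Its square comes from equating
  \<open>card_pairs_B\<close> with \<open>card_pairs_Q\<close>, substituting \<open>N0_N1\<close>
  for the field size and cancelling \<open>CARD('f) - 1\<close>.\<close>

lemma N0_N1_square: "(int N0 - int N1)^2 = int (card R) * int CARD('a)"
proof -
  have "card R \<le> CARD('a)" by (rule card_mono) auto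
  then obtain k where k: "CARD('a) = card R + k" using le_Suc_ex by blast
  obtain l where l: "CARD('f) = Suc l" "l > 0"
    using P_gt_1 by (cases "CARD('f)") auto
  have "CARD('a) = N0 + l * N1" using N0_N1 l by simp
  hence q: "int CARD('a) = int N0 + int l * int N1" by simp
  have "Suc l * (N0^2 + l * N1^2) = Suc l * card R * CARD('a) + k * CARD('a)"
    using card_pairs_B card_pairs_Q k l by simp
  hence "int (Suc l * (N0^2 + l * N1^2)) = int (Suc l * card R * CARD('a) + k * CARD('a))"
    by (rule arg_cong)
  hence "(int l + 1) * (int N0^2 + int l * int N1^2)
      = (int l + 1) * int (card R) * int CARD('a) + int k * int CARD('a)"
    by (simp add: algebra_simps)
  moreover have "int k = int CARD('a) - int (card R)" using k by simp
  ultimately have "(int l + 1) * (int N0^2 + int l * int N1^2)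
      = (int l + 1) * int (card R) * int CARD('a) + (int CARD('a) - int (card R)) * int CARD('a)"
    by (simp only:)
  also have "\<dots> = int l * (int (card R) * int CARD('a)) + int CARD('a) * int CARD('a)"
    by (simp only: algebra_simps)
  also have "int CARD('a) * int CARD('a) = (int N0 + int l * int N1)^2"
    by (simp only: q power2_eq_square)
  finally have "int l * (int N0 - int N1)^2 = int l * (int (card R) * int CARD('a))"
    by (simp only: power2_eq_square) (simp only: algebra_simps)
  thus ?thesis using l by simp
qed

section \<open>Zeros of the form on the fibers of a linear functional\<close>

definition M :: "'a \<Rightarrow> 'f \<Rightarrow> nat" where "M x s = card {y. Q y = 0 \<and> T (x * y) = s}"

lemma M_L: "M (L a) s = card {y. Q y = 0 \<and> B a y = s}"
  by (simp add: M_def B_def mult.commute)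


lemma card_T_fiber_subspace:
  assumes S: "\<And>x y. x \<in> S \<Longrightarrow> y \<in> S \<Longrightarrow> x + y \<in> S" "\<And>s x. x \<in> S \<Longrightarrow> emb s * x \<in> S"
    and r: "r \<in> S" "T (x * r) \<noteq> 0"
  shows "CARD('f) * card {y \<in> S. T (x * y) = s} = card S"
proof (rule card_fiber_of_translations[where h = "\<lambda>s. emb (s / T (x * r)) * r"])
  fix y s
  have "T (x * (emb (s / T (x * r)) * r)) = (s / T (x * r)) * T (x * r)"
    using T_scale[of "s / T (x * r)" "x * r"] by (simp add: mult.left_commute)
  thus "T (x * (y + emb (s / T (x * r)) * r)) = T (x * y) + s"
    using r by (simp add: distrib_left T_add)
qed (use S r in auto)

definition annihilator :: "'a set" where "annihilator = {x. \<forall>r\<in>R. T (x * r) = 0}"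

text \<open>Count the pairs \<open>(r, x)\<close> with \<open>r \<in> R\<close> and
  \<open>T (x * r) = 0\<close> twice. By \<open>r\<close>: everything for \<open>r = 0\<close>, a
  hyperplane of the field otherwise. By \<open>x\<close>: all of \<open>R\<close> for
  \<open>x\<close> in the annihilator, a hyperplane of \<open>R\<close> otherwise.\<close>

lemma card_annihilator: "card annihilator * card R = CARD('a)"
proof -
  have le: "card R \<le> CARD('a)" "card annihilator \<le> CARD('a)" by (rule card_mono; simp)+
  have R1: "card R \<ge> 1" using R_0 card_0_eq[of R] by (fastforce simp: Suc_le_eq)
  have "{(r, x). r \<in> R \<and> T (x * r) = 0} = prod.swap ` {(x, r). x \<in> UNIV \<and> r \<in> R \<and> T (x * r) = 0}"
    by auto
  hence "card {(r, x). r \<in> R \<and> T (x * r) = 0} = card {(x, r). x \<in> UNIV \<and> r \<in> R \<and> T (x * r) = 0}"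
    by (simp only: card_image[OF inj_swap])
  hence "(\<Sum>r\<in>R. card {x. T (x * r) = 0}) = (\<Sum>x\<in>UNIV. card {r. r \<in> R \<and> T (x * r) = 0})"
    by (subst (asm) (1 2) card_pairs) auto
  hence "(\<Sum>r\<in>R. CARD('f) * card {x. T (x * r) = 0})
      = (\<Sum>x\<in>UNIV. CARD('f) * card {r. r \<in> R \<and> T (x * r) = 0})"
    by (simp flip: sum_distrib_left)
  also have "(\<Sum>r\<in>R. CARD('f) * card {x. T (x * r) = 0})
      = (\<Sum>r\<in>{0}. CARD('f) * card {x. T (x * r) = 0}) + (\<Sum>r\<in>R - {0}. CARD('f) * card {x. T (x * r) = 0})"
    using R_0 by (subst sum.subset_diff[of "{0}" R]) auto
  also have "(\<Sum>r\<in>R - {0}. CARD('f) * card {x. T (x * r) = 0}) = (\<Sum>r\<in>R - {0}. CARD('a))"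
    by (rule sum.cong) (use card_T_fiber in \<open>auto simp: mult.commute\<close>)
  also have "(\<Sum>x\<in>UNIV. CARD('f) * card {r. r \<in> R \<and> T (x * r) = 0})
      = (\<Sum>x\<in>annihilator. CARD('f) * card {r. r \<in> R \<and> T (x * r) = 0})
        + (\<Sum>x\<in>UNIV - annihilator. CARD('f) * card {r. r \<in> R \<and> T (x * r) = 0})"
    by (subst sum.subset_diff[of annihilator UNIV]) auto
  also have "(\<Sum>x\<in>annihilator. CARD('f) * card {r. r \<in> R \<and> T (x * r) = 0})
      = (\<Sum>x\<in>annihilator. CARD('f) * card R)"
    by (rule sum.cong) (auto simp: annihilator_def intro: arg_cong[where f = card])
  also have "(\<Sum>x\<in>UNIV - annihilator. CARD('f) * card {r. r \<in> R \<and> T (x * r) = 0})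
      = (\<Sum>x\<in>UNIV - annihilator. card R)"
    by (rule sum.cong)
      (use card_T_fiber_subspace[of R] R_add R_scale in \<open>auto simp: annihilator_def\<close>)
  finally have eq: "CARD('f) * CARD('a) + (card R - 1) * CARD('a)
      = card annihilator * (CARD('f) * card R) + (CARD('a) - card annihilator) * card R"
    using R_0 by (simp add: card_Diff_subset)
  obtain l where l: "CARD('f) = Suc l" "l > 0"
    using P_gt_1 by (cases "CARD('f)") auto
  obtain k where k: "card R = Suc k" using R1 by (cases "card R") auto
  obtain j where j: "CARD('a) = card annihilator + j" using le le_Suc_ex by blast
  have "l * CARD('a) + card R * CARD('a) = CARD('f) * CARD('a) + (card R - 1) * CARD('a)"
    using l k by simp
  also have "\<dots> = l * (card annihilator * card R) + card R * (card annihilator + j)"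
    unfolding eq using l j by (simp add: algebra_simps)
  finally have "l * CARD('a) = l * (card annihilator * card R)" using j by simp
  thus ?thesis using l by simp
qed

text \<open>\<open>L\<close> is additive with kernel \<open>R\<close>, so on a union of cosets of
  \<open>R\<close> its fibers are full cosets. Applied to the field, to the zeros and to the
  nonzeros of \<open>Q\<close>, this yields all multiplicities.\<close>

lemma card_L_image:
  assumes "\<And>x r. x \<in> S \<Longrightarrow> r \<in> R \<Longrightarrow> x + r \<in> S"
  shows "card (L ` S) * card R = card S"
proof -
  have "card S = (\<Sum>y\<in>L ` S. card {x \<in> S. L x = y})"
    using sum.image_gen[of S "\<lambda>_. 1::nat" L] by simp
  also have "\<dots> = (\<Sum>y\<in>L ` S. card R)"
  proof (rule sum.cong[OF refl])
    fix y assume "y \<in> L ` S"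
    then obtain a where a: "a \<in> S" "y = L a" by auto
    have "bij_betw (\<lambda>r. a + r) R {x \<in> S. L x = y}"
    proof (rule bij_betw_byWitness[where f' = "\<lambda>x. x - a"])
      show "(\<lambda>x. x - a) ` {x \<in> S. L x = y} \<subseteq> R"
        using L_add[of _ "-a"] by (auto simp: R_def a L_minus)
      show "(+) a ` R \<subseteq> {x \<in> S. L x = y}"
        using assms a by (auto simp: R_def L_add)
    qed auto
    thus "card {x \<in> S. L x = y} = card R" by (rule bij_betw_same_card[symmetric])
  qed
  finally show ?thesis by simp
qed

text \<open>One inclusion is the symmetry of \<open>B\<close>; the other follows because both sets
  have \<open>CARD('a) / card R\<close> elements. It turns \<open>x \<notin> range L\<close> into
  the existence of some \<open>r\<close> in \<open>R\<close> with
  \<open>T (x * r) \<noteq> 0\<close>.\<close>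

lemma annihilator_eq: "annihilator = range L"
proof (rule card_subset_eq[symmetric])
  have "T (L a * r) = 0" if "r \<in> R" for a r
    using R_B(2)[OF that, of a] by (simp add: B_def mult.commute)
  thus "range L \<subseteq> annihilator" by (auto simp: annihilator_def)
  have "card (range L) * card R = card annihilator * card R"
    using card_L_image[of UNIV] card_annihilator by simp
  moreover have "R \<noteq> {}" using R_0 by auto
  ultimately show "card (range L) = card annihilator" by simp
qed simp

lemma M_not_range:
  assumes "x \<notin> range L"
  shows "CARD('f) * M x s = N0"
proof -
  obtain r where r: "r \<in> R" "T (x * r) \<noteq> 0"
    using assms unfolding annihilator_eq[symmetric] by (auto simp: annihilator_def)
  have "CARD('f) * card {y \<in> {y. Q y = 0}. T (x * y) = s} = card {y. Q y = 0}"
  proof (rule card_fiber_of_translations[where h = "\<lambda>s. emb (s / T (x * r)) * r"])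
    fix y s
    show "y + emb (s / T (x * r)) * r \<in> {y. Q y = 0}" if "y \<in> {y. Q y = 0}"
      using that r by (simp add: Q_add_R R_scale)
    have "T (x * (emb (s / T (x * r)) * r)) = (s / T (x * r)) * T (x * r)"
      using T_scale[of "s / T (x * r)" "x * r"] by (simp add: mult.left_commute)
    thus "T (x * (y + emb (s / T (x * r)) * r)) = T (x * y) + s"
      using r by (simp add: distrib_left T_add)
  qed auto
  thus ?thesis by (simp add: M_def N0_def)
qed

lemma sum_M: "(\<Sum>s\<in>UNIV. M x s) = N0"
  using card_eq_sum_fibers[of "{y. Q y = 0}" "\<lambda>y. T (x * y)"] by (simp add: M_def N0_def)

text \<open>The zeros of \<open>Q\<close> form a cone, so scaling moves the trace value 1 to any
  nonzero \<open>s\<close>. Together with \<open>M_0\<close> this leaves a single value of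
  \<open>M x\<close> to be computed for each class of \<open>x\<close>.\<close>

lemma M_scale:
  assumes "s \<noteq> 0"
  shows "M x s = M x 1"
proof -
  have "bij_betw (\<lambda>y. emb s * y) {y. Q y = 0 \<and> T (x * y) = 1} {y. Q y = 0 \<and> T (x * y) = s}"
  proof (rule bij_betw_byWitness[where f' = "\<lambda>y. emb (inverse s) * y"])
    have inv: "emb s * emb (inverse s) = 1" using assms by (simp flip: emb_mult add: emb_1)
    have T: "T (x * (emb t * y)) = t * T (x * y)" for t y
      using T_scale[of t "x * y"] by (simp add: mult.left_commute)
    show "\<forall>y\<in>{y. Q y = 0 \<and> T (x * y) = 1}. emb (inverse s) * (emb s * y) = y"
      "\<forall>y\<in>{y. Q y = 0 \<and> T (x * y) = s}. emb s * (emb (inverse s) * y) = y"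
      using inv by (simp_all flip: mult.assoc) (simp add: mult.commute)
    show "(*) (emb s) ` {y. Q y = 0 \<and> T (x * y) = 1} \<subseteq> {y. Q y = 0 \<and> T (x * y) = s}"
      "(*) (emb (inverse s)) ` {y. Q y = 0 \<and> T (x * y) = s} \<subseteq> {y. Q y = 0 \<and> T (x * y) = 1}"
      using assms by (auto simp: T Q_scale)
  qed
  thus ?thesis unfolding M_def by (rule bij_betw_same_card[symmetric])
qed

lemma M_0: "M x 0 + (CARD('f) - 1) * M x 1 = N0"
proof -
  have "(\<Sum>s\<in>UNIV. M x s) = M x 0 + (\<Sum>s\<in>UNIV - {0}. M x s)"
    by (rule sum.remove) auto
  also have "(\<Sum>s\<in>UNIV - {0}. M x s) = (\<Sum>s\<in>(UNIV - {0} :: 'f set). M x 1)"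
    by (rule sum.cong[OF refl], rule M_scale) simp
  also have "\<dots> = (CARD('f) - 1) * M x 1" by (simp add: card_Diff_subset)
  finally show ?thesis by (simp add: sum_M)
qed

text \<open>Since \<open>B a a = 0\<close>, moving along \<open>a\<close> stays inside the affine
  hyperplane \<open>B a y = 1\<close>, and there it shifts \<open>Q y\<close> by exactly
  \<open>s\<close>. On \<open>B a y = 0\<close> the same motion would leave \<open>Q\<close>
  unchanged, which is why the value 1 is the one computed.\<close>

lemma M_isotropic:
  assumes "Q a = 0" "a \<notin> R"
  shows "CARD('f)^2 * M (L a) 1 = CARD('a)"
proof -
  have Baa: "B a a = 0" using assms B_self by simp
  have "CARD('f) * card {y \<in> {y. B a y = 1}. Q y = 0} = card {y. B a y = 1}"
    by (rule card_fiber_of_translations[where h = "\<lambda>s. emb s * a"])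
      (auto simp: B_add_right B_scale_right Baa Q_line assms)
  also have "{y \<in> {y. B a y = 1}. Q y = 0} = {y. Q y = 0 \<and> B a y = 1}" by auto
  finally have "CARD('f) * (CARD('f) * M (L a) 1) = CARD('f) * card {y. B a y = 1}"
    by (simp add: M_L)
  thus ?thesis using card_B_fiber[OF assms(2)] by (simp add: power2_eq_square mult.assoc)
qed

text \<open>Points of a hyperbola; for \<open>u = 0\<close> it degenerates to two axes that share
  the origin, hence the subtracted 1.\<close>

lemma card_mult_eq:
  fixes u :: 'f
  shows "card {(\<alpha>, \<beta>). \<alpha> * \<beta> = u} = (if u = 0 then 2 * CARD('f) - 1 else CARD('f) - 1)"
proof -
  have "card {(\<alpha>, \<beta>). \<alpha> \<in> (UNIV::'f set) \<and> \<alpha> * \<beta> = u} = (\<Sum>\<alpha>\<in>UNIV. card {\<beta>. \<alpha> * \<beta> = u})"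
    by (rule card_pairs) auto
  also have "\<dots> = card {\<beta>. (0::'f) * \<beta> = u} + (\<Sum>\<alpha>\<in>UNIV - {0}. card {\<beta>. \<alpha> * \<beta> = u})"
    by (rule sum.remove) auto
  also have "card {\<beta>. (0::'f) * \<beta> = u} = (if u = 0 then CARD('f) else 0)" by simp
  also have "(\<Sum>\<alpha>\<in>UNIV - {0}. card {\<beta>. \<alpha> * \<beta> = u}) = (\<Sum>\<alpha>\<in>(UNIV - {0} :: 'f set). 1)"
  proof (rule sum.cong[OF refl])
    fix \<alpha> :: 'f assume "\<alpha> \<in> UNIV - {0}"
    hence "{\<beta>. \<alpha> * \<beta> = u} = {u / \<alpha>}" by (auto simp: field_simps)
    thus "card {\<beta>. \<alpha> * \<beta> = u} = 1" by simp
  qed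
  also have "\<dots> = CARD('f) - 1" by (simp add: card_Diff_subset)
  finally show ?thesis using P_gt_1 by (auto simp: mult_2)
qed

text \<open>
  Solutions of $Q(y) = Q(a) v^2$ are counted twice: by $v$, and after splitting off the
  hyperbolic plane spanned by $a$ and the unit vector of the $v$-axis.
\<close>

lemma M_anisotropic:
  assumes "Q a \<noteq> 0"
  shows "CARD('f)^2 * M (L a) 0 = CARD('a)"
proof -
  define k where "k = Q a"
  have k: "k \<noteq> 0" using assms by (simp add: k_def)
  have Baa: "B a a = 2 * k" by (simp add: B_self k_def)
  have aR: "a \<notin> R" using Q_R assms by auto
  \<comment> \<open>The set \<open>X\<close> has \<open>CARD('a)\<close> elements:
    \<open>v = 0\<close> contributes \<open>N0\<close> and each other \<open>v\<close> contributes
    \<open>N1\<close>, exactly as in \<open>N0_N1\<close>.\<close>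
  define X where "X = {(v, y). v \<in> UNIV \<and> Q y = k * v^2}"
  define Y where "Y = {(w, z). w \<in> {w. B a w = 0} \<and> z \<in> {(\<alpha>, \<beta>). \<alpha> * \<beta> = Q w / k}}"
  define W where "W = card {w. B a w = 0}"
  define h where "h = M (L a) 0"
  have "card X = (\<Sum>v\<in>UNIV. card {y. Q y = k * v^2})"
    unfolding X_def by (rule card_pairs) auto
  also have "\<dots> = card {y. Q y = k * 0^2} + (\<Sum>v\<in>UNIV - {0}. card {y. Q y = k * v^2})"
    by (rule sum.remove) auto
  also have "(\<Sum>v\<in>UNIV - {0}. card {y. Q y = k * v^2}) = (\<Sum>v\<in>(UNIV - {0} :: 'f set). N1)"
    by (rule sum.cong) (use k in \<open>auto simp: card_Q_nonzero\<close>)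
  also have "\<dots> = (CARD('f) - 1) * N1" by (simp add: card_Diff_subset)
  also have "card {y. Q y = k * 0^2} = N0" by (simp add: N0_def)
  finally have X: "card X = CARD('a)" using N0_N1 by simp
  have "card Y = (\<Sum>w\<in>{w. B a w = 0}. card {z. z \<in> {(\<alpha>, \<beta>). \<alpha> * \<beta> = Q w / k}})"
    unfolding Y_def by (rule card_pairs) auto
  also have "\<dots> = (\<Sum>w\<in>{w. B a w = 0}. if Q w = 0 then 2 * CARD('f) - 1 else CARD('f) - 1)"
    using k by (simp add: card_mult_eq)
  also have "\<dots> = (\<Sum>w\<in>{w. B a w = 0}. (CARD('f) - 1) + (if Q w = 0 then CARD('f) else 0))"
    by (rule sum.cong) (use P_gt_1 in auto)
  also have "\<dots> = W * (CARD('f) - 1) + h * CARD('f)"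
    by (simp only: sum.distrib) (simp add: W_def h_def M_L sum.If_cases Int_def conj_commute)
  finally have Y: "card Y = W * (CARD('f) - 1) + h * CARD('f)" .
  \<comment> \<open>The coordinate of \<open>y\<close> along \<open>a\<close> in the orthogonal
    splitting \<open>y = w + emb (l y) * a\<close> with \<open>B a w = 0\<close>. Then
    \<open>Q y = Q w + k * (l y)^2\<close>, and \<open>Q y = k * v^2\<close> becomes
    \<open>(v - l y) * (v + l y) = Q w / k\<close>.\<close>
  define l where "l y = B a y / (2 * k)" for y
  have l: "l (w + emb s * a) = s" if "B a w = 0" for w s
    using that two k by (simp add: l_def B_add_right B_scale_right Baa)
  have l0: "B a (y - emb (l y) * a) = 0" for y
  proof -
    have "B a (y - emb (l y) * a) = B a y - l y * B a a"
      using B_add_right[of a y "- (emb (l y) * a)"] by (simp add: B_minus_right B_scale_right)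
    thus ?thesis using two k by (simp add: Baa l_def)
  qed
  have Ql: "Q y = Q (y - emb (l y) * a) + (l y)^2 * k" for y
    using Q_line[of "y - emb (l y) * a" "l y" a] l0[of y] by (simp add: k_def)
  have half: "(\<alpha> + \<beta>) / 2 - (\<beta> - \<alpha>) / 2 = \<alpha>" "(\<alpha> + \<beta>) / 2 + (\<beta> - \<alpha>) / 2 = \<beta>"
    "(v + t - (v - t)) / 2 = t" "(v - t + (v + t)) / 2 = v" for \<alpha> \<beta> v t :: 'f
  proof -
    have *: "(2 * x) / 2 = x" for x :: 'f using two by (metis nonzero_mult_div_cancel_left)
    have "\<alpha> + \<beta> - (\<beta> - \<alpha>) = 2 * \<alpha>" "\<alpha> + \<beta> + (\<beta> - \<alpha>) = 2 * \<beta>"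
      "v + t - (v - t) = 2 * t" "v - t + (v + t) = 2 * v" by simp_all
    thus "(\<alpha> + \<beta>) / 2 - (\<beta> - \<alpha>) / 2 = \<alpha>" "(\<alpha> + \<beta>) / 2 + (\<beta> - \<alpha>) / 2 = \<beta>"
      "(v + t - (v - t)) / 2 = t" "(v - t + (v + t)) / 2 = v"
      by (simp_all only: * flip: add_divide_distrib diff_divide_distrib)
  qed
  have "bij_betw (\<lambda>(v, y). (y - emb (l y) * a, v - l y, v + l y)) X Y"
  proof (rule bij_betw_byWitness[where
        f' = "\<lambda>(w, \<alpha>, \<beta>). ((\<alpha> + \<beta>) / 2, w + emb ((\<beta> - \<alpha>) / 2) * a)"])
    have "(v - l y) * (v + l y) = Q (y - emb (l y) * a) / k" if "Q y = k * v^2" for v y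
    proof -
      have "k * ((v - l y) * (v + l y)) = k * v^2 - (l y)^2 * k"
        by (simp add: algebra_simps power2_eq_square)
      also have "\<dots> = Q (y - emb (l y) * a)" using Ql[of y] that by simp
      finally show ?thesis using k by (simp add: field_simps)
    qed
    thus "(\<lambda>(v, y). (y - emb (l y) * a, v - l y, v + l y)) ` X \<subseteq> Y"
      by (auto simp: X_def Y_def l0)
    have "Q (w + emb ((\<beta> - \<alpha>) / 2) * a) = k * ((\<alpha> + \<beta>) / 2)^2"
      if "B a w = 0" "\<alpha> * \<beta> = Q w / k" for w \<alpha> \<beta>
    proof -
      define s where "s = (\<beta> - \<alpha>) / 2"
      define v where "v = (\<alpha> + \<beta>) / 2"
      have "v - s = \<alpha>" "v + s = \<beta>" using half by (simp_all add: s_def v_def)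
      hence "Q w = k * ((v - s) * (v + s))" using that k by simp
      moreover have "Q (w + emb s * a) = Q w + s^2 * k" using that by (simp add: Q_line k_def)
      ultimately have "Q (w + emb s * a) = k * v^2"
        by (simp only: power2_eq_square) (simp add: algebra_simps)
      thus ?thesis by (simp only: s_def v_def)
    qed
    thus "(\<lambda>(w, \<alpha>, \<beta>). ((\<alpha> + \<beta>) / 2, w + emb ((\<beta> - \<alpha>) / 2) * a)) ` Y \<subseteq> X"
      by (auto simp: X_def Y_def)
  next
    show "\<forall>z\<in>X. (\<lambda>(w, \<alpha>, \<beta>). ((\<alpha> + \<beta>) / 2, w + emb ((\<beta> - \<alpha>) / 2) * a))
        ((\<lambda>(v, y). (y - emb (l y) * a, v - l y, v + l y)) z) = z"
      using half by auto
    show "\<forall>z\<in>Y. (\<lambda>(v, y). (y - emb (l y) * a, v - l y, v + l y))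
        ((\<lambda>(w, \<alpha>, \<beta>). ((\<alpha> + \<beta>) / 2, w + emb ((\<beta> - \<alpha>) / 2) * a)) z) = z"
      using half l by (auto simp: Y_def)
  qed
  hence "card X = card Y" by (rule bij_betw_same_card)
  hence "CARD('a) = W * (CARD('f) - 1) + h * CARD('f)" using X Y by simp
  moreover have W: "CARD('f) * W = CARD('a)" unfolding W_def by (rule card_B_fiber[OF aR])
  moreover obtain j where "CARD('f) = Suc j" using P_gt_1 by (cases "CARD('f)") auto
  \<comment> \<open>Both expressions for \<open>CARD('a)\<close> contain
    \<open>W * (CARD('f) - 1)\<close>; cancelling it leaves this identity.\<close>
  ultimately have "W = CARD('f) * h" by (simp add: mult.commute)
  thus ?thesis using W by (simp add: power2_eq_square h_def mult.assoc)
qed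

end

section \<open>Dimension and cardinality\<close>

lemma (in vectorspace) card_carrier_eq_power_dim:
  assumes "finite (carrier K)" "finite (carrier V)"
  shows "card (carrier V) = card (carrier K) ^ dim"
proof -
  have "carrier V \<subseteq> span (carrier V)" by (rule in_own_span) simp
  hence "gen_set (carrier V)" using span_is_subset2[of "carrier V"] by auto
  hence "fin_dim" unfolding fin_dim_def using assms(2) by blast
  then obtain \<beta> where \<beta>: "finite \<beta>" "basis \<beta>" using finite_basis_exists by blast
  hence sub: "\<beta> \<subseteq> carrier V" by (simp add: basis_def)
  have crit: "\<And>v. v \<in> carrier V \<Longrightarrow> \<exists>!f. f \<in> \<beta> \<rightarrow>\<^sub>E carrier K \<and> lincomb f \<beta> = v"
    using basis_criterion[OF \<beta>(1) sub] \<beta>(2) by blast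
  have closed: "lincomb f \<beta> \<in> carrier V" if "f \<in> \<beta> \<rightarrow>\<^sub>E carrier K" for f
    using that sub by (intro lincomb_closed) auto
  have "bij_betw (\<lambda>f. lincomb f \<beta>) (\<beta> \<rightarrow>\<^sub>E carrier K) (carrier V)"
  proof (rule bij_betw_imageI)
    show "inj_on (\<lambda>f. lincomb f \<beta>) (\<beta> \<rightarrow>\<^sub>E carrier K)"
      by (rule inj_onI) (metis closed crit)
    show "(\<lambda>f. lincomb f \<beta>) ` (\<beta> \<rightarrow>\<^sub>E carrier K) = carrier V"
      using closed crit by (auto simp: image_iff) metis
  qed
  hence "card (carrier V) = card (\<beta> \<rightarrow>\<^sub>E carrier K)" by (rule bij_betw_same_card[symmetric])
  also have "\<dots> = card (carrier K) ^ card \<beta>" using \<beta>(1) by (simp add: card_PiE)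
  also have "card \<beta> = dim" using dim_basis[OF \<beta>] by simp
  finally show ?thesis .
qed

text \<open>Over a finite field the cardinality of a subspace determines its dimension, so no basis
  of the code has to be exhibited.\<close>

lemma linear_codeI:
  fixes W :: "'f::{field,finite} vec set"
  assumes "subspace class_ring W (module_vec TYPE('f) n)" "card W = CARD('f) ^ k"
  shows "linear_code n k W"
proof -
  interpret V: vec_space "TYPE('f)" n .
  have W: "finite W" using assms(2) by (intro card_ge_0_finite) simp
  interpret W: vectorspace class_ring "module_vec TYPE('f) n\<lparr>carrier := W\<rparr>"
    using V.subspace_is_vs[OF assms(1)] by simp
  have "CARD('f) ^ k = CARD('f) ^ W.dim"
    using W.card_carrier_eq_power_dim W assms(2) by simp
  moreover have "CARD('f) > 1" using card_mono[of UNIV "{0, 1 :: 'f}"] by simp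
  ultimately have "W.dim = k" by simp
  thus ?thesis using assms(1) by (simp add: linear_code_def)
qed

section \<open>Finite fields\<close>

lemma finite_field_power_CARD: "(x :: 'a::{field,finite}) ^ CARD('a) = x"
proof (cases "x = 0")
  case False
  have "(\<Prod>y\<in>UNIV - {0}. x * y) = \<Prod>(UNIV - {0} :: 'a set)"
    by (rule prod.reindex_bij_witness[of _ "\<lambda>y. y / x" "\<lambda>y. x * y"]) (use False in auto)
  hence "x ^ (CARD('a) - 1) * \<Prod>(UNIV - {0} :: 'a set) = \<Prod>(UNIV - {0} :: 'a set)"
    by (simp add: prod.distrib card_Diff_subset)
  moreover have "\<Prod>(UNIV - {0} :: 'a set) \<noteq> 0" by simp
  ultimately have "x ^ (CARD('a) - 1) = 1" by (metis mult_cancel_right1)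
  hence "x ^ Suc (CARD('a) - 1) = x" by (simp only: power_Suc mult_1_right)
  moreover have "Suc (CARD('a) - 1) = CARD('a)" by (rule Suc_diff_1) simp
  ultimately show ?thesis by (simp only:)
qed simp

lemma finite_field_power_CARD_minus_1: "(x :: 'a::{field,finite}) \<noteq> 0 \<Longrightarrow> x ^ (CARD('a) - 1) = 1"
  using finite_field_power_CARD[of x] power_Suc[of x "CARD('a) - 1"] by (simp add: Suc_diff_1)

lemma finite_field_generator:
  obtains g :: "'a::{field,finite}"
  where "g \<noteq> 0" "bij_betw (\<lambda>i. g ^ i) {..<CARD('a) - 1} (UNIV - {0})"
proof -
  have "\<exists>a \<in> carrier (mult_of (class_ring :: 'a ring)).
      carrier (mult_of (class_ring :: 'a ring)) = {a [^]\<^bsub>class_ring\<^esub> i | i::nat. i \<in> UNIV}"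
    by (rule field.finite_field_mult_group_has_gen[OF class_field]) simp
  then obtain g :: 'a where g: "g \<noteq> 0" "UNIV - {0} = {g ^ i | i::nat. i \<in> UNIV}"
    by (auto simp: class_ring_simps)
  have n: "CARD('a) - 1 > 0"
    using card_mono[of UNIV "{0, 1 :: 'a}"] by simp
  have "UNIV - {0} \<subseteq> (\<lambda>i. g ^ i) ` {..<CARD('a) - 1}"
  proof
    fix x :: 'a assume "x \<in> UNIV - {0}"
    then obtain i where i: "x = g ^ i" using g by auto
    have "g ^ i = g ^ (i div (CARD('a) - 1) * (CARD('a) - 1) + i mod (CARD('a) - 1))"
      by (simp only: div_mult_mod_eq)
    also have "\<dots> = g ^ (i mod (CARD('a) - 1))"
      using finite_field_power_CARD_minus_1[OF g(1)]
      by (simp only: power_add power_mult mult.commute[of "i div _"]) simp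
    finally show "x \<in> (\<lambda>i. g ^ i) ` {..<CARD('a) - 1}" using i n by auto
  qed
  moreover have "(\<lambda>i. g ^ i) ` {..<CARD('a) - 1} \<subseteq> UNIV - {0}" using g(1) by auto
  ultimately have im: "(\<lambda>i. g ^ i) ` {..<CARD('a) - 1} = UNIV - {0}" by blast
  have "inj_on (\<lambda>i. g ^ i) {..<CARD('a) - 1}"
    by (rule eq_card_imp_inj_on) (simp, simp only: im, simp add: card_Diff_subset)
  thus ?thesis using that g(1) im by (auto simp: bij_betw_def)
qed

lemma generator_power_eq_1_iff:
  fixes g :: "'a::{field,finite}"
  assumes "g \<noteq> 0" "bij_betw (\<lambda>i. g ^ i) {..<CARD('a) - 1} (UNIV - {0})"
  shows "g ^ i = 1 \<longleftrightarrow> CARD('a) - 1 dvd i"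
proof -
  have n: "CARD('a) - 1 > 0"
    using card_mono[of UNIV "{0, 1 :: 'a}"] by simp
  have "g ^ i = g ^ (i div (CARD('a) - 1) * (CARD('a) - 1) + i mod (CARD('a) - 1))"
      by (simp only: div_mult_mod_eq)
  also have "\<dots> = g ^ (i mod (CARD('a) - 1))"
    using finite_field_power_CARD_minus_1[OF assms(1)]
    by (simp only: power_add power_mult mult.commute[of "i div _"]) simp
  finally have "g ^ i = 1 \<longleftrightarrow> g ^ (i mod (CARD('a) - 1)) = g ^ 0" by simp
  also have "\<dots> \<longleftrightarrow> i mod (CARD('a) - 1) = 0"
    by (rule inj_on_eq_iff[of "\<lambda>i. g ^ i" "{..<CARD('a) - 1}"])
      (use assms n in \<open>auto simp: bij_betw_def\<close>)
  finally show ?thesis by (simp add: dvd_eq_mod_eq_0)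
qed

lemma card_roots_of_unity:
  assumes "k dvd CARD('a::{field,finite}) - 1"
  shows "card {z :: 'a. z ^ k = 1} = k"
proof -
  obtain g :: 'a where g: "g \<noteq> 0" "bij_betw (\<lambda>i. g ^ i) {..<CARD('a) - 1} (UNIV - {0})"
    using finite_field_generator .
  obtain l where l: "CARD('a) - 1 = k * l" using assms by blast
  have "CARD('a) - 1 > 0"
    using card_mono[of UNIV "{0, 1 :: 'a}"] by simp
  hence kl: "k > 0" "l > 0" using l by (auto intro: Nat.gr0I)
  have "bij_betw (\<lambda>j. g ^ (l * j)) {..<k} {z :: 'a. z ^ k = 1}"
  proof (rule bij_betw_imageI)
    show "inj_on (\<lambda>j. g ^ (l * j)) {..<k}"
    proof (rule inj_onI)
      fix x y assume *: "x \<in> {..<k}" "y \<in> {..<k}" "g ^ (l * x) = g ^ (l * y)"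
      have "l * x < k * l" "l * y < k * l" using * kl by auto
      hence "l * x = l * y"
        using inj_onD[of "\<lambda>i. g ^ i" "{..<CARD('a) - 1}" "l * x" "l * y"] g(2) *(3) l
        by (auto simp: bij_betw_def)
      thus "x = y" using kl by simp
    qed
    show "(\<lambda>j. g ^ (l * j)) ` {..<k} = {z. z ^ k = 1}"
    proof (intro equalityI subsetI)
      fix z assume "z \<in> (\<lambda>j. g ^ (l * j)) ` {..<k}"
      then obtain j where "z = g ^ (l * j)" by auto
      hence "z ^ k = g ^ (l * j * k)" by (simp add: power_mult)
      also have "\<dots> = 1" using generator_power_eq_1_iff[OF g] l by simp
      finally show "z \<in> {z. z ^ k = 1}" by simp
    next
      fix z :: 'a assume z: "z \<in> {z. z ^ k = 1}"
      hence "z \<noteq> 0" using kl by (auto simp: power_0_left)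
      then obtain i where i: "i < k * l" "z = g ^ i" using g(2) l by (auto simp: bij_betw_def)
      hence "g ^ (i * k) = 1" using z by (simp add: power_mult)
      hence "k * l dvd i * k" using generator_power_eq_1_iff[OF g] l by simp
      hence "l dvd i" using kl by (simp add: mult.commute)
      then obtain j where "i = l * j" by blast
      thus "z \<in> (\<lambda>j. g ^ (l * j)) ` {..<k}" using i kl by (auto simp: mult.commute)
    qed
  qed
  thus ?thesis using bij_betw_same_card by fastforce
qed

lemma power_iterate_eq:
  fixes z :: "'a::monoid_mult"
  assumes "z ^ b = z"
  shows "z ^ (b ^ k) = z"
  by (induction k) (simp_all add: assms power_mult)

text \<open>Modulo \<open>b + 1\<close> the number \<open>b\<close> is -1. Needed for the exponent
  \<open>a\<close> in the action of the roots of unity and for \<open>2 * k + 1\<close> in fixing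
  the sign.\<close>

lemma Suc_dvd_odd_power:
  assumes "odd k"
  shows "b + 1 dvd b ^ k + (1::nat)"
proof -
  obtain j where k: "k = 2 * j + 1" using assms by (auto elim: oddE)
  have "int b + 1 dvd int b ^ (2 * j + 1) + 1"
  proof (induction j)
    case (Suc j)
    have "int b ^ (2 * Suc j + 1) + 1 = int b ^ 2 * (int b ^ (2 * j + 1) + 1) - (int b - 1) * (int b + 1)"
      by (simp add: algebra_simps power2_eq_square)
    thus ?case using Suc by (simp only: dvd_diff dvd_mult dvd_triv_right)
  qed simp
  hence "int (b + 1) dvd int (b ^ k + 1)" unfolding k by (simp only: of_nat_add of_nat_power of_nat_1)
  thus ?thesis by (simp only: of_nat_dvd_iff)
qed

lemma CHAR_eq:
  assumes "CARD('a::{field,finite}) = CARD('p::prime_card) ^ e"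
  shows "CHAR('a) = CARD('p)"
proof -
  have "prime CHAR('a)" by (intro prime_CHAR_semidom finite_imp_CHAR_pos) simp
  moreover have "CHAR('a) dvd CARD('p) ^ e" using CHAR_dvd_CARD[where 'a = 'a] assms by simp
  ultimately show ?thesis using prime_card[where 'a = 'p] prime_dvd_power primes_dvd_imp_eq by blast
qed

section \<open>The prime subfield and the trace\<close>

definition prime_field_emb :: "'p::prime_card mod_ring \<Rightarrow> 'a::{field,finite}" where
  "prime_field_emb t = of_int (to_int_mod_ring t)"

context
  fixes e :: nat and TA :: "'a::{field,finite} itself" and TP :: "'p::prime_card itself"
  assumes q: "CARD('a) = CARD('p) ^ e"
begin

abbreviation (input) emb :: "'p mod_ring \<Rightarrow> 'a" where "emb \<equiv> prime_field_emb"

lemma prime_field_emb_add: "emb (s + t) = emb s + emb t"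
  unfolding prime_field_emb_def to_int_mod_ring_add using CHAR_eq[OF q] of_int_mod_CHAR
  by (metis of_int_add)

lemma prime_field_emb_mult: "emb (s * t) = emb s * emb t"
  unfolding prime_field_emb_def to_int_mod_ring_mult using CHAR_eq[OF q] of_int_mod_CHAR
  by (metis of_int_mult)

lemma prime_field_emb_1: "emb 1 = 1"
  by (simp add: prime_field_emb_def)

lemma prime_field_emb_0: "emb 0 = 0"
  by (simp add: prime_field_emb_def)

lemma inj_prime_field_emb: "inj emb"
proof (rule injI)
  fix s t assume "emb s = emb t"
  moreover have "emb (s - t) + emb t = emb s" using prime_field_emb_add[of "s - t" t] by simp
  ultimately have 0: "emb (s - t) = 0" by simp
  show "s = t"
  proof (rule ccontr)
    assume "s \<noteq> t"
    hence "emb (s - t) * emb (inverse (s - t)) = 1"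
      using prime_field_emb_mult[of "s - t" "inverse (s - t)"] prime_field_emb_1 by simp
    thus False using 0 by simp
  qed
qed

lemma prime_field_emb_power: "emb t ^ CARD('p) = emb t"
proof -
  have "emb (t ^ k) = emb t ^ k" for k
    by (induction k) (simp_all add: prime_field_emb_1 prime_field_emb_mult)
  moreover have "t ^ CARD('p) = t" using finite_field_power_CARD[of t] by simp
  ultimately show ?thesis by metis
qed

text \<open>The prime subfield is the fixed field of Frobenius: it consists of fixed points, and the
  polynomial with these roots has degree at most \<open>CARD('p)\<close>.\<close>

lemma range_prime_field_emb: "range emb = {y. y ^ CARD('p) = y}"
proof (rule card_subset_eq)
  show "range emb \<subseteq> {y. y ^ CARD('p) = y}" using prime_field_emb_power by auto
  have p: "CARD('p) > 1" using prime_card[where 'a = 'p] prime_gt_1_nat by blast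
  define f :: "'a poly" where "f = monom 1 CARD('p) - monom 1 1"
  have "coeff f CARD('p) = 1" using p by (simp add: f_def)
  hence "f \<noteq> 0" by auto
  have "degree f \<le> CARD('p)" unfolding f_def
    by (rule degree_diff_le) (use p in \<open>auto simp: degree_monom_eq\<close>)
  moreover have "{y. y ^ CARD('p) = y} = {y. poly f y = 0}" by (simp add: f_def poly_monom)
  ultimately have "card {y :: 'a. y ^ CARD('p) = y} \<le> CARD('p)"
    using card_poly_roots_bound[OF \<open>f \<noteq> 0\<close>] by simp
  moreover have "card (range emb) = CARD('p)" using inj_prime_field_emb by (simp add: card_image)
  moreover have "card (range emb) \<le> card {y :: 'a. y ^ CARD('p) = y}"
    by (rule card_mono) (use prime_field_emb_power in auto)
  ultimately show "card (range emb) = card {y :: 'a. y ^ CARD('p) = y}" by simp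
qed simp

lemma frobenius_add: "(x + y :: 'a) ^ (CARD('p) ^ k) = x ^ (CARD('p) ^ k) + y ^ (CARD('p) ^ k)"
  using freshmans_dream'[of "CARD('p) ^ k" k x y] CHAR_eq[OF q] by (simp add: prime_card)

lemma sum_frobenius_shift: "(\<Sum>i<e. (x::'a) ^ (CARD('p) ^ Suc i)) = (\<Sum>i<e. x ^ (CARD('p) ^ i))"
proof -
  have "(\<Sum>i<e. x ^ (CARD('p) ^ Suc i)) + x = (\<Sum>i<Suc e. x ^ (CARD('p) ^ i))"
    by (subst sum.lessThan_Suc_shift) simp
  also have "\<dots> = (\<Sum>i<e. x ^ (CARD('p) ^ i)) + x"
    using finite_field_power_CARD[of x] q by simp
  finally show ?thesis by simp
qed

abbreviation (input) tr :: "'a \<Rightarrow> 'p mod_ring" where "tr \<equiv> field_trace e"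

text \<open>Frobenius permutes the summands cyclically, so the sum lies in the prime subfield;
  injectivity of the embedding then makes the definite description in \<open>field_trace\<close>
  meaningful. The algebraic rules for the trace are proved on the embedded side.\<close>

lemma emb_field_trace: "emb (tr x) = (\<Sum>i<e. x ^ (CARD('p) ^ i))"
proof -
  have "(\<Sum>i<e. x ^ (CARD('p) ^ i)) ^ CARD('p) = (\<Sum>i<e. (x ^ (CARD('p) ^ i)) ^ CARD('p))"
    by (rule freshmans_dream_sum) (use CHAR_eq[OF q] prime_card[where 'a = 'p] in simp_all)
  also have "\<dots> = (\<Sum>i<e. x ^ (CARD('p) ^ Suc i))"
    by (simp only: power_Suc2 power_mult)
  finally have "(\<Sum>i<e. x ^ (CARD('p) ^ i)) \<in> range emb"
    unfolding range_prime_field_emb by (simp only: sum_frobenius_shift mem_Collect_eq)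
  then obtain t where t: "emb t = (\<Sum>i<e. x ^ (CARD('p) ^ i))" by auto
  have "tr x = t" unfolding field_trace_def
    by (rule the_equality) (use t inj_prime_field_emb in \<open>auto simp: prime_field_emb_def inj_def\<close>)
  thus ?thesis using t by simp
qed

lemma field_trace_add: "tr (x + y) = tr x + tr y"
  by (rule injD[OF inj_prime_field_emb])
    (simp add: emb_field_trace prime_field_emb_add frobenius_add sum.distrib)

lemma prime_field_emb_frobenius: "emb t ^ (CARD('p) ^ k) = emb t"
  by (rule power_iterate_eq) (rule prime_field_emb_power)

lemma field_trace_scale: "tr (emb t * x) = t * tr x"
  by (rule injD[OF inj_prime_field_emb])
    (simp add: emb_field_trace prime_field_emb_mult power_mult_distrib prime_field_emb_frobenius
      sum_distrib_left)

lemma field_trace_frobenius: "tr (x ^ (CARD('p) ^ k)) = tr x"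
proof (induction k)
  case (Suc k)
  define y where "y = x ^ (CARD('p) ^ k)"
  have "(\<Sum>i<e. (y ^ CARD('p)) ^ (CARD('p) ^ i)) = (\<Sum>i<e. y ^ (CARD('p) ^ Suc i))"
    by (simp flip: power_mult)
  also have "\<dots> = (\<Sum>i<e. y ^ (CARD('p) ^ i))" by (rule sum_frobenius_shift)
  finally have "emb (tr (y ^ CARD('p))) = emb (tr y)" by (simp only: emb_field_trace)
  hence "tr (y ^ CARD('p)) = tr y" by (rule injD[OF inj_prime_field_emb])
  moreover have "y ^ CARD('p) = x ^ (CARD('p) ^ Suc k)"
    by (simp add: y_def mult.commute flip: power_mult)
  ultimately show ?case using Suc by (simp only: y_def)
qed simp

text \<open>A trace vanishing everywhere would give a polynomial of degree at most
  \<open>p ^ (e - 1)\<close> with \<open>p ^ e\<close> roots. The polynomial is not zero because its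
  coefficient at degree 1 comes from \<open>i = 0\<close> alone.\<close>

lemma field_trace_nonzero:
  assumes "e > 0"
  shows "\<exists>x. tr x \<noteq> 0"
proof (rule ccontr)
  assume "\<not> ?thesis"
  hence 0: "(\<Sum>i<e. x ^ (CARD('p) ^ i)) = 0" for x :: 'a
    using emb_field_trace[of x] by (simp add: prime_field_emb_0)
  have p: "CARD('p) > 1" using prime_card[where 'a = 'p] prime_gt_1_nat by blast
  define f :: "'a poly" where "f = (\<Sum>i<e. monom 1 (CARD('p) ^ i))"
  have "coeff f 1 = (\<Sum>i<e. if i = 0 then 1 else 0)"
    unfolding f_def coeff_sum by (rule sum.cong) (use p in auto)
  also have "\<dots> = 1" using assms by (simp add: sum.delta)
  finally have "f \<noteq> 0" by auto
  have "degree f \<le> CARD('p) ^ (e - 1)" unfolding f_def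
    by (rule degree_sum_le) (use p in \<open>auto simp: degree_monom_eq intro!: power_increasing\<close>)
  moreover have "{x. poly f x = 0} = UNIV" using 0 by (simp add: f_def poly_sum poly_monom)
  ultimately have "CARD('a) \<le> CARD('p) ^ (e - 1)" using card_poly_roots_bound[OF \<open>f \<noteq> 0\<close>] by simp
  moreover have "CARD('p) ^ (e - 1) < CARD('p) ^ e"
    using p assms by (intro power_strict_increasing) auto
  ultimately show False using q by simp
qed

end

lemma pred_dvd_power_pred: "(x - 1 :: nat) dvd x ^ k - 1"
proof (cases "x = 0")
  case False
  have "int x - 1 dvd int x ^ k - 1"
  proof (induction k)
    case (Suc k)
    have "int x ^ Suc k - 1 = int x * (int x ^ k - 1) + (int x - 1)" by (simp add: algebra_simps)
    thus ?case using Suc by (simp only: dvd_add dvd_mult dvd_refl)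
  qed simp
  moreover have "int (x - 1) = int x - 1" "int (x ^ k - 1) = int x ^ k - 1"
    using False by (simp_all add: of_nat_diff Suc_le_eq)
  ultimately have "int (x - 1) dvd int (x ^ k - 1)" by (simp only:)
  thus ?thesis by (simp only: of_nat_dvd_iff)
qed (cases k; simp)

lemma power_iterate_gcd:
  fixes z :: "'a::monoid_mult"
  assumes "z ^ (b ^ k) = z" "z ^ (b ^ l) = z" "k \<noteq> 0"
  shows "z ^ (b ^ gcd k l) = z"
proof -
  obtain x y where xy: "k * x = l * y + gcd k l" using bezout_nat[OF assms(3)] by blast
  have "z = z ^ (b ^ (k * x))" using power_iterate_eq[OF assms(1)] by (simp only: power_mult)
  also have "\<dots> = (z ^ (b ^ (l * y))) ^ (b ^ gcd k l)" by (simp only: xy power_add power_mult)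
  also have "z ^ (b ^ (l * y)) = z" using power_iterate_eq[OF assms(2)] by (simp only: power_mult)
  finally show ?thesis by simp
qed

lemma power_iterate_minus:
  fixes y :: "'a::comm_ring_1"
  assumes "y ^ b = - y" "odd b"
  shows "y ^ (b ^ j) = (-1) ^ j * y"
proof (induction j)
  case (Suc j)
  have "y ^ (b ^ Suc j) = (y ^ b) ^ (b ^ j)" by (simp add: power_mult)
  also have "\<dots> = - (y ^ (b ^ j))" using assms by (simp add: power_minus_odd)
  finally show ?case using Suc by simp
qed simp

section \<open>The form $Tr(x^{p^\<alpha>+1})$\<close>

text \<open>The quotients \<open>\<alpha> div d\<close> and \<open>m div (2 * d)\<close> appear as
  parameters \<open>a\<close> and \<open>k\<close>, which removes all divisions;
  \<open>gcd_a\<close> restates that \<open>d\<close> is the gcd of \<open>\<alpha>\<close> and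
  \<open>e\<close>.\<close>

locale trace_power_form =
  fixes m \<alpha> e d p b a k :: nat and TA :: "'a::{field,finite} itself" and TP :: "'p::prime_card itself"
  assumes p_def: "p = CARD('p)"
    and odd_p: "odd p"
    and card_p: "CARD('a) = p ^ e"
    and b_def: "b = p ^ d"
    and d_pos: "d > 0"
    and a_pos: "a > 0"
    and k_pos: "k > 0"
    and \<alpha>_a: "\<alpha> = d * a"
    and m_k: "m = d * (2 * k)"
    and e_eq: "e = 2 * m"
    and gcd_a: "gcd a (4 * k) = 1"
begin

lemma card_eq: "CARD('a) = CARD('p) ^ e"
  using card_p by (simp add: p_def)

lemma p_ge: "p \<ge> 3"
proof -
  have "p > 1" using prime_card[where 'a = 'p] prime_gt_1_nat unfolding p_def by blast
  moreover have "p \<noteq> 2" using odd_p by auto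
  ultimately show ?thesis by simp
qed

lemma e_k: "e = d * (4 * k)"
  by (simp add: e_eq m_k)

lemma odd_a: "odd a"
proof
  assume "even a"
  hence "2 dvd gcd a (4 * k)" by simp
  thus False by (simp only: gcd_a) simp
qed

text \<open>The radical is governed by the power \<open>b ^ (2 * a)\<close>, while every element is
  fixed by the power \<open>b ^ (4 * k)\<close>; this gcd reduces the two conditions to the power
  \<open>b^2\<close>.\<close>

lemma gcd_2a: "gcd (2 * a) (4 * k) = 2"
proof -
  have "coprime a (2 * k)"
    using gcd_a unfolding coprime_iff_gcd_eq_1[symmetric]
    by (rule coprime_divisors[rotated 2]) auto
  moreover have "gcd (2 * a) (2 * (2 * k)) = 2 * gcd a (2 * k)" by (rule gcd_mult_distrib_nat[symmetric])
  ultimately show ?thesis by (simp add: mult.assoc)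
qed

lemma p_\<alpha>: "p ^ \<alpha> = b ^ a"
  by (simp add: b_def \<alpha>_a power_mult)

lemma card_b: "CARD('a) = b ^ (4 * k)"
  by (simp add: card_p b_def e_k power_mult)

lemma odd_b: "odd b"
  using odd_p by (simp add: b_def)

lemma b_ge: "b \<ge> 3"
proof -
  have "p ^ 1 \<le> p ^ d" using p_ge d_pos by (intro power_increasing) auto
  thus ?thesis using p_ge by (simp add: b_def)
qed

lemma e_pos: "e > 0"
  using d_pos k_pos by (simp add: e_k)

text \<open>The extra factor 2 is the even number \<open>b^2 + 1\<close> in \<open>b^4 - 1\<close>.
  It is what provides an element whose \<open>(b^2 - 1)\<close>-st power is -1.\<close>

lemma b2_dvd: "2 * (b^2 - 1) dvd CARD('a) - 1"
proof -
  have "2 dvd b^2 + 1" using odd_b by simp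
  hence "2 * (b^2 - 1) dvd (b^2 + 1) * (b^2 - 1)" by (rule mult_dvd_mono) simp
  also have "(b^2 + 1) * (b^2 - 1) = b^4 - 1"
    by (simp add: diff_mult_distrib2 algebra_simps flip: power_add)
  also have "\<dots> dvd (b^4)^k - 1" by (rule pred_dvd_power_pred)
  also have "(b^4)^k - 1 = CARD('a) - 1" by (simp add: card_b power_mult)
  finally show ?thesis .
qed

lemma b_plus_1_mult: "(b + 1) * (b - 1) = b^2 - 1"
  by (simp add: diff_mult_distrib2 algebra_simps power2_eq_square)

lemma b_plus_1_dvd: "(b + 1) * (b - 1) dvd CARD('a) - 1"
  unfolding b_plus_1_mult using b2_dvd by (rule dvd_mult_right)

lemma power_b_4k: "(x :: 'a) ^ (b ^ (4 * k)) = x"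
  using finite_field_power_CARD[of x] card_b by simp

section \<open>The form, its radical and the sign\<close>

definition emb :: "'p mod_ring \<Rightarrow> 'a" where "emb = prime_field_emb"

definition T :: "'a \<Rightarrow> 'p mod_ring" where "T = field_trace e"

definition Q :: "'a \<Rightarrow> 'p mod_ring" where "Q x = T (x ^ (p ^ \<alpha> + 1))"

text \<open>The second summand is the inverse of the \<open>p ^ \<alpha>\<close> power map, written
  with a positive exponent by means of \<open>x ^ (p ^ (\<alpha> * e)) = x\<close>.\<close>

definition L :: "'a \<Rightarrow> 'a" where "L x = x ^ (p ^ \<alpha>) + x ^ (p ^ (\<alpha> * (e - 1)))"

lemma T_add: "T (x + y) = T x + T y"
  unfolding T_def by (rule field_trace_add[OF card_eq])

lemma T_scale: "T (emb t * x) = t * T x"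
  unfolding T_def emb_def by (rule field_trace_scale[OF card_eq])

lemma T_frobenius: "T (x ^ (p ^ i)) = T x"
  unfolding T_def p_def by (rule field_trace_frobenius[OF card_eq])

lemma frobenius: "(x + y :: 'a) ^ (p ^ i) = x ^ (p ^ i) + y ^ (p ^ i)"
  unfolding p_def by (rule frobenius_add[OF card_eq])

lemma power_p_\<alpha>_e: "(x :: 'a) ^ (p ^ (\<alpha> * e)) = x"
proof -
  have "x ^ (p ^ e) = x" using finite_field_power_CARD[of x] card_p by simp
  hence "x ^ ((p ^ e) ^ \<alpha>) = x" by (rule power_iterate_eq)
  thus ?thesis by (simp add: mult.commute flip: power_mult)
qed

lemma Q_add: "Q (x + y) = Q x + Q y + T (y * L x)"
proof -
  \<comment> \<open>The trace is invariant under the inverse power map, which frees \<open>y\<close>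
    of its exponent and moves the inverse power to \<open>x\<close>.\<close>
  have "T (y ^ (p ^ \<alpha>) * x) = T ((y ^ (p ^ \<alpha>) * x) ^ (p ^ (\<alpha> * (e - 1))))"
    by (rule T_frobenius[symmetric])
  also have "(y ^ (p ^ \<alpha>) * x) ^ (p ^ (\<alpha> * (e - 1))) = y ^ (p ^ \<alpha> * p ^ (\<alpha> * (e - 1))) * x ^ (p ^ (\<alpha> * (e - 1)))"
    by (simp only: power_mult_distrib power_mult)
  also have "p ^ \<alpha> * p ^ (\<alpha> * (e - 1)) = p ^ (\<alpha> * e)"
    using e_pos by (simp flip: power_add add: algebra_simps)
  also have "y ^ (p ^ (\<alpha> * e)) = y" by (rule power_p_\<alpha>_e)
  finally have *: "T (y ^ (p ^ \<alpha>) * x) = T (y * x ^ (p ^ (\<alpha> * (e - 1))))" .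
  have "(x + y) ^ (p ^ \<alpha> + 1) = x ^ (p ^ \<alpha> + 1) + y ^ (p ^ \<alpha> + 1) + y * x ^ (p ^ \<alpha>) + y ^ (p ^ \<alpha>) * x"
    by (simp add: power_add frobenius algebra_simps)
  hence "Q (x + y) = Q x + Q y + T (y * x ^ (p ^ \<alpha>)) + T (y ^ (p ^ \<alpha>) * x)"
    by (simp only: Q_def T_add)
  thus ?thesis unfolding * L_def by (simp add: T_add distrib_left)
qed

lemma Q_scale: "Q (emb s * x) = s^2 * Q x"
proof -
  have "emb s ^ (p ^ \<alpha>) = emb s"
    unfolding emb_def p_def by (rule prime_field_emb_frobenius[OF card_eq])
  hence "(emb s * x) ^ (p ^ \<alpha> + 1) = emb s * (emb s * x ^ (p ^ \<alpha> + 1))"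
    by (simp add: power_mult_distrib algebra_simps)
  thus ?thesis by (simp only: Q_def T_scale) (simp add: power2_eq_square)
qed

text \<open>Scalars of the prime field are norms from the field of order $b^2$ to the field of order $b$.\<close>

lemma Q_similar:
  assumes "t \<noteq> 0"
  shows "\<exists>z. z \<noteq> 0 \<and> (\<forall>x. Q (z * x) = t * Q x)"
proof -
  obtain g :: 'a where g: "g \<noteq> 0" "bij_betw (\<lambda>i. g ^ i) {..<CARD('a) - 1} (UNIV - {0})"
    using finite_field_generator .
  have "emb t \<noteq> emb 0"
    using inj_prime_field_emb[OF card_eq] assms by (auto simp: emb_def dest: injD)
  hence t0: "emb t \<noteq> 0" by (simp add: emb_def prime_field_emb_0[OF card_eq])
  then obtain i where i: "emb t = g ^ i" using g(2) by (auto simp: bij_betw_def)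
  have "emb t ^ b = emb t"
    unfolding emb_def b_def p_def by (rule prime_field_emb_frobenius[OF card_eq])
  moreover have "b = Suc (b - 1)" using b_ge by simp
  ultimately have "emb t * emb t ^ (b - 1) = emb t" by (metis power_Suc)
  hence "emb t ^ (b - 1) = 1" using t0 by simp
  hence "g ^ (i * (b - 1)) = 1" by (simp add: i power_mult)
  hence n: "CARD('a) - 1 dvd i * (b - 1)" using generator_power_eq_1_iff[OF g] by simp
  obtain l where l: "CARD('a) - 1 = (b + 1) * (b - 1) * l" using b_plus_1_dvd by blast
  have "(b + 1) * (b - 1) * l = (b + 1) * l * (b - 1)" by (simp only: mult_ac)
  hence nd: "(b + 1) * l * (b - 1) dvd i * (b - 1)" using n l by (simp only:)
  have cancel: "x dvd y" if "x * c dvd y * c" "c \<noteq> 0" for x y c :: nat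
    using that by simp
  have "(b + 1) * l dvd i" by (rule cancel[OF nd]) (use b_ge in simp)
  then obtain j where j: "i = (b + 1) * l * j" by blast
  define z where "z = g ^ (l * j)"
  have "l * j * (b + 1) = i" by (simp only: j mult_ac)
  hence zb: "z ^ (b + 1) = emb t" by (simp only: z_def i flip: power_mult)
  have "l * j * (b^2 - 1) = (CARD('a) - 1) * j" by (simp only: l mult_ac flip: b_plus_1_mult)
  hence "z ^ (b^2 - 1) = g ^ ((CARD('a) - 1) * j)" by (simp only: z_def flip: power_mult)
  also have "\<dots> = 1" by (simp only: power_mult finite_field_power_CARD_minus_1[OF g(1)] power_one)
  finally have "z ^ Suc (b^2 - 1) = z" by simp
  moreover have "Suc (b^2 - 1) = b^2" using b_ge by simp
  ultimately have "z ^ (b^2) = z" by (simp only:)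
  hence zz: "z ^ ((b^2) ^ j) = z" for j by (rule power_iterate_eq)
  \<comment> \<open>As \<open>z\<close> is fixed by the \<open>b^2\<close> power and
    \<open>a\<close> is odd, \<open>z ^ (b ^ a) = z ^ b\<close>; thus the norm
    \<open>z ^ (b + 1)\<close> is also the factor by which \<open>z\<close> scales
    \<open>Q\<close>.\<close>
  obtain a' where a': "a = 2 * a' + 1" using odd_a by (auto elim: oddE)
  have "z ^ (b ^ a) = (z ^ ((b^2) ^ a')) ^ b"
    by (simp add: a' power_mult mult.commute flip: power_mult)
  hence za: "z ^ (p ^ \<alpha> + 1) = emb t" by (simp add: zz p_\<alpha> flip: zb)
  have "Q (z * x) = t * Q x" for x
    by (simp only: Q_def power_mult_distrib za T_scale)
  moreover have "z \<noteq> 0" by (simp add: z_def g)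
  ultimately show ?thesis by blast
qed

sublocale trace_quadratic_form emb T L Q
proof
  show "emb (s + t) = emb s + emb t" for s t
    unfolding emb_def by (rule prime_field_emb_add[OF card_eq])
  show "emb (s * t) = emb s * emb t" for s t
    unfolding emb_def by (rule prime_field_emb_mult[OF card_eq])
  show "emb 1 = 1" unfolding emb_def by (rule prime_field_emb_1[OF card_eq])
  show "(2 :: 'p mod_ring) \<noteq> 0"
  proof
    assume "(2 :: 'p mod_ring) = 0"
    hence "CARD('p) dvd 2" using of_nat_0_mod_ring_dvd[of 2, where 'a = 'p] by simp
    hence "CARD('p) \<le> 2" by (rule dvd_imp_le) simp
    thus False using p_ge by (simp add: p_def)
  qed
  show "\<exists>x. T x \<noteq> 0" unfolding T_def by (rule field_trace_nonzero[OF card_eq e_pos])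
  show "L (x + y) = L x + L y" for x y by (simp add: L_def frobenius)
qed (fact T_add T_scale Q_add Q_scale Q_similar)+

text \<open>The injective \<open>p ^ \<alpha>\<close> power map is applied to \<open>L x = 0\<close>
  in order to cancel the inverse power in \<open>L\<close>.\<close>

lemma R_iff: "x \<in> R \<longleftrightarrow> x ^ (b ^ (2 * a)) = - x"
proof -
  have "x \<in> R \<longleftrightarrow> (L x) ^ (p ^ \<alpha>) = 0" using p_ge by (simp add: R_def)
  also have "(L x) ^ (p ^ \<alpha>) = x ^ (p ^ \<alpha> * p ^ \<alpha>) + x ^ (p ^ (\<alpha> * (e - 1)) * p ^ \<alpha>)"
    by (simp only: L_def frobenius power_mult)
  also have "p ^ (\<alpha> * (e - 1)) * p ^ \<alpha> = p ^ (\<alpha> * e)"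
    using e_pos by (simp flip: power_add add: algebra_simps)
  also have "p ^ \<alpha> * p ^ \<alpha> = b ^ (2 * a)" by (simp add: p_\<alpha> mult_2 power_add)
  finally show ?thesis by (simp add: power_p_\<alpha>_e add_eq_0_iff2)
qed

lemma card_fixed_b2: "card {z :: 'a. z ^ (b^2) = z} = b^2"
proof -
  have b2: "b^2 = Suc (b^2 - 1)" "b^2 - 1 > 0"
    using b_ge power_mono[of 3 b 2] by simp_all
  have "z ^ (b^2) = z \<longleftrightarrow> z = 0 \<or> z ^ (b^2 - 1) = 1" for z :: 'a
    by (subst b2(1)) (simp add: power_Suc)
  hence "{z :: 'a. z ^ (b^2) = z} = insert 0 {z. z ^ (b^2 - 1) = 1}" by auto
  moreover have "(0 :: 'a) \<notin> {z. z ^ (b^2 - 1) = 1}" using b2 by (simp add: power_0_left)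
  moreover have "card {z :: 'a. z ^ (b^2 - 1) = 1} = b^2 - 1"
    by (rule card_roots_of_unity) (use b2_dvd dvd_mult_right in blast)
  ultimately show ?thesis using b2(1) by simp
qed

text \<open>One nonzero solution \<open>y\<close> of \<open>y ^ (b^2) = - y\<close> suffices: since
  \<open>a\<close> is odd it lies in \<open>R\<close>, and division by \<open>y\<close> turns the
  equation for \<open>R\<close> into being fixed by the \<open>b ^ (2 * a)\<close> power, hence by
  the \<open>b^2\<close> power. So \<open>R\<close> is \<open>y\<close> times the subfield of order
  \<open>b^2\<close>.\<close>

lemma card_R: "card R = p ^ (2 * d)"
proof -
  obtain g :: 'a where g: "g \<noteq> 0" "bij_betw (\<lambda>i. g ^ i) {..<CARD('a) - 1} (UNIV - {0})"
    using finite_field_generator .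
  obtain l where l: "CARD('a) - 1 = 2 * (b^2 - 1) * l" using b2_dvd by blast
  have n: "CARD('a) - 1 > 0"
    using card_mono[of UNIV "{0, 1 :: 'a}"] by simp
  \<comment> \<open>With this exponent the \<open>(b^2 - 1)\<close>-st power of \<open>y\<close> is
    the square root of 1 other than 1.\<close>
  define y where "y = g ^ l"
  have y0: "y \<noteq> 0" by (simp add: y_def g)
  have "(y ^ (b^2 - 1))^2 = g ^ (CARD('a) - 1)"
    unfolding l y_def by (simp add: mult_ac flip: power_mult)
  hence "(y ^ (b^2 - 1))^2 = 1" using finite_field_power_CARD_minus_1[OF g(1)] by simp
  moreover have "y ^ (b^2 - 1) \<noteq> 1"
  proof
    assume "y ^ (b^2 - 1) = 1"
    hence "g ^ (l * (b^2 - 1)) = 1" by (simp add: y_def power_mult)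
    hence "2 * (l * (b^2 - 1)) dvd l * (b^2 - 1)"
      using generator_power_eq_1_iff[OF g] l by (simp add: mult_ac)
    moreover have "l > 0" using n l by (auto intro: Nat.gr0I)
    moreover have "b^2 - 1 > 0" using b_ge power_mono[of 3 b 2] by simp
    ultimately show False using dvd_imp_le[of "2 * (l * (b^2 - 1))" "l * (b^2 - 1)"] by simp
  qed
  ultimately have "y ^ (b^2 - 1) = -1" by (simp add: power2_eq_1_iff)
  hence "y ^ Suc (b^2 - 1) = - y" by simp
  moreover have "Suc (b^2 - 1) = b^2" using b_ge by simp
  ultimately have "y ^ (b^2) = - y" by (simp only:)
  hence "y ^ ((b^2) ^ a) = (-1) ^ a * y" by (rule power_iterate_minus) (use odd_b in simp)
  hence ya: "y ^ (b ^ (2 * a)) = - y" using odd_a by (simp add: power_mult)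
  have "bij_betw (\<lambda>z. y * z) {z. z ^ (b^2) = z} R"
  proof (rule bij_betw_byWitness[where f' = "\<lambda>x. x / y"])
    have "y * z \<in> R" if "z ^ (b^2) = z" for z
    proof -
      have "z ^ ((b^2) ^ a) = z" using that by (rule power_iterate_eq)
      thus ?thesis by (simp add: R_iff power_mult_distrib ya) (simp add: power_mult)
    qed
    thus "(*) y ` {z. z ^ (b^2) = z} \<subseteq> R" by auto
    have "(x / y) ^ (b^2) = x / y" if "x \<in> R" for x
    proof -
      have "(x / y) ^ (b ^ (2 * a)) = x / y" using that ya by (simp add: R_iff power_divide)
      moreover have "(x / y) ^ (b ^ (4 * k)) = x / y" by (rule power_b_4k)
      ultimately have "(x / y) ^ (b ^ gcd (2 * a) (4 * k)) = x / y"
        by (rule power_iterate_gcd) (use a_pos in simp)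
      thus ?thesis by (simp only: gcd_2a)
    qed
    thus "(\<lambda>x. x / y) ` R \<subseteq> {z. z ^ (b^2) = z}" by auto
  qed (use y0 in auto)
  hence "card {z :: 'a. z ^ (b^2) = z} = card R" by (rule bij_betw_same_card)
  hence "card R = b^2" by (simp only: card_fixed_b2)
  thus ?thesis by (simp add: b_def mult.commute flip: power_mult)
qed

text \<open>The group of $(b+1)$-st roots of unity acts freely on $\{x. Q(x) = 1\}$.\<close>

lemma dvd_N1: "b + 1 dvd N1"
proof -
  define S where "S = {x. Q x = 1}"
  have "card S = (\<Sum>w\<in>(\<lambda>x. x ^ (b + 1)) ` S. card {x \<in> S. x ^ (b + 1) = w})"
    using sum.image_gen[of S "\<lambda>_. 1::nat" "\<lambda>x. x ^ (b + 1)"] by simp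
  also have "\<dots> = (\<Sum>w\<in>(\<lambda>x. x ^ (b + 1)) ` S. b + 1)"
  proof (rule sum.cong[OF refl])
    fix w assume "w \<in> (\<lambda>x. x ^ (b + 1)) ` S"
    then obtain x where x: "Q x = 1" "w = x ^ (b + 1)" by (auto simp: S_def)
    hence x0: "x \<noteq> 0" using Q_0 by auto
    have Qz: "Q (x' * z) = Q x'" if "z ^ (b + 1) = 1" for x' z
    proof -
      obtain j where "b ^ a + 1 = (b + 1) * j" using Suc_dvd_odd_power[OF odd_a] by blast
      hence "z ^ (p ^ \<alpha> + 1) = 1" by (simp only: p_\<alpha> power_mult that power_one)
      thus ?thesis by (simp only: Q_def power_mult_distrib mult_1_right)
    qed
    have "bij_betw (\<lambda>z. x * z) {z. z ^ (b + 1) = 1} {x \<in> S. x ^ (b + 1) = w}"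
    proof (rule bij_betw_byWitness[where f' = "\<lambda>y. y / x"])
      show "(*) x ` {z. z ^ (b + 1) = 1} \<subseteq> {x \<in> S. x ^ (b + 1) = w}"
      proof safe
        fix z :: 'a assume z: "z ^ (b + 1) = 1"
        show "x * z \<in> S" using Qz[OF z] x by (simp add: S_def)
        show "(x * z) ^ (b + 1) = w" by (simp only: power_mult_distrib z x mult_1_right)
      qed
      have "(y / x) ^ (b + 1) = 1" if "y ^ (b + 1) = w" for y
        using x x0 that by (simp only: power_divide) simp
      thus "(\<lambda>y. y / x) ` {x \<in> S. x ^ (b + 1) = w} \<subseteq> {z. z ^ (b + 1) = 1}"
        by blast
    qed (use x0 in auto)
    hence "card {x \<in> S. x ^ (b + 1) = w} = card {z :: 'a. z ^ (b + 1) = 1}"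
      by (rule bij_betw_same_card[symmetric])
    also have "\<dots> = b + 1"
      by (rule card_roots_of_unity) (use b_plus_1_dvd dvd_mult_left in blast)
    finally show "card {x \<in> S. x ^ (b + 1) = w} = b + 1" .
  qed
  also have "\<dots> = card ((\<lambda>x. x ^ (b + 1)) ` S) * (b + 1)" by (simp only: sum_constant of_nat_id)
  finally show ?thesis unfolding N1_def S_def[symmetric] by (simp only: dvd_triv_right)
qed

lemma N0_N1_p: "N0 + (p - 1) * N1 = p ^ e"
  using N0_N1 by (simp only: card_p CARD_mod_ring flip: p_def)

text \<open>With the opposite sign the field size would be \<open>p * N1 + b ^ (2 * k + 1)\<close>,
  which is -1 modulo \<open>b + 1\<close> by \<open>dvd_N1\<close>. But it equals
  \<open>b ^ (4 * k)\<close>, which is 1, so \<open>b + 1\<close> would divide 2.\<close>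

lemma N1_eq_N0: "N1 = N0 + p ^ (m + d)"
proof -
  have "(int N0 - int N1)^2 = int (card R * CARD('a))" using N0_N1_square by simp
  also have "card R * CARD('a) = p ^ (2 * d + e)" by (simp only: card_R card_p power_add)
  also have "2 * d + e = (m + d) * 2" by (simp add: e_eq)
  also have "p ^ ((m + d) * 2) = (p ^ (m + d))^2" by (rule power_mult)
  finally have "(int N0 - int N1)^2 = (int (p ^ (m + d)))^2" by simp
  hence "int N0 - int N1 = int (p ^ (m + d)) \<or> int N0 - int N1 = - int (p ^ (m + d))"
    by (simp only: power2_eq_iff)
  moreover have False if "int N0 - int N1 = int (p ^ (m + d))"
  proof -
    have "m + d = d * (2 * k + 1)" by (simp add: m_k)
    hence "p ^ (m + d) = b ^ (2 * k + 1)" by (simp only: b_def power_mult)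
    hence 1: "b + 1 dvd p ^ (m + d) + 1" using Suc_dvd_odd_power[of "2 * k + 1" b] by simp
    have "int N0 = int (N1 + p ^ (m + d))" using that by simp
    hence "N0 = N1 + p ^ (m + d)" by (simp only: of_nat_eq_iff)
    hence "CARD('a) + 1 = N1 * (1 + (p - 1)) + (p ^ (m + d) + 1)"
      using N0_N1_p by (simp only: card_p distrib_left) (simp add: mult.commute)
    hence "b + 1 dvd CARD('a) + 1" using 1 dvd_N1 by (simp only: dvd_add dvd_mult2)
    moreover have "b + 1 dvd CARD('a) - 1" using b_plus_1_dvd dvd_mult_left by blast
    ultimately have "b + 1 dvd CARD('a) + 1 - (CARD('a) - 1)" by (rule dvd_diff_nat)
    also have "CARD('a) + 1 - (CARD('a) - 1) = 2"
      using card_mono[of UNIV "{0, 1 :: 'a}"] by simp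
    finally have "b + 1 \<le> 2" by (rule dvd_imp_le) simp
    thus False using b_ge by simp
  qed
  ultimately have "int N1 = int (N0 + p ^ (m + d))" by auto
  thus ?thesis by (simp only: of_nat_eq_iff)
qed

text \<open>
  All counts are expressed through $p^{e-2}$ and $p^{m+d-2}$. Differences of the closed formulas
  are written as sums, which avoids truncated subtraction.
\<close>

lemma exponents: "m \<ge> 2 * d" "m \<ge> 2"
proof -
  have "2 * d \<le> d * (2 * k)" "2 \<le> d * (2 * k)"
    using k_pos d_pos by (simp_all add: Suc_le_eq)
  thus "m \<ge> 2 * d" "m \<ge> 2" by (simp_all add: m_k)
qed

section \<open>Closed formulas for the counts\<close>

definition A :: nat where "A = p ^ (e - 2)"

definition E :: nat where "E = p ^ (m + d - 2)"

lemma p_pow_e: "p ^ e = p * (p * A)" "p ^ (e - 1) = p * A"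
proof -
  have "e = Suc (Suc (e - 2))" "e - 1 = Suc (e - 2)" using exponents e_eq by simp_all
  thus "p ^ e = p * (p * A)" "p ^ (e - 1) = p * A" unfolding A_def by (metis power_Suc)+
qed

lemma p_pow_md: "p ^ (m + d) = p * (p * E)" "p ^ (m + d - 1) = p * E"
proof -
  have "m + d = Suc (Suc (m + d - 2))" "m + d - 1 = Suc (m + d - 2)" using exponents by simp_all
  thus "p ^ (m + d) = p * (p * E)" "p ^ (m + d - 1) = p * E" unfolding E_def by (metis power_Suc)+
qed

lemma N1_val: "N1 = p * A + p * E"
proof -
  have *: "l * n1 = x + y" if "n0 + (l - 1) * n1 = x" "n1 = n0 + y" "l > 0" for l n0 n1 x y :: nat
    using that by (cases l) auto
  have "p * N1 = p ^ e + p ^ (m + d)" by (rule *[OF N0_N1_p N1_eq_N0]) (use p_ge in simp)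
  hence "p * N1 = p * (p * A + p * E)" by (simp only: p_pow_e p_pow_md distrib_left)
  thus ?thesis using p_ge by simp
qed

lemma N0_val: "N0 + (p - 1) * (p * E) = p * A"
proof -
  have *: "n0 + (l - 1) * y = x" if "n1 = n0 + l * y" "n1 = x + y" "l > 0" for l n0 n1 x y :: nat
    using that by (cases l) auto
  show ?thesis by (rule *[OF N1_eq_N0[unfolded p_pow_md] N1_val]) (use p_ge in simp)
qed

lemma M_val_not_range:
  assumes "x \<notin> range L"
  shows "M x s + (p - 1) * E = A"
proof -
  have "p * M x s = N0" using M_not_range[OF assms] by (simp add: p_def)
  hence "p * (M x s + (p - 1) * E) = p * A" using N0_val by (simp add: distrib_left mult.left_commute)
  thus ?thesis using p_ge by simp
qed

lemma M_0_p: "M x 0 + (p - 1) * M x 1 = N0"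
  using M_0[of x] by (simp only: CARD_mod_ring flip: p_def)

lemma M_val_isotropic:
  assumes "x \<in> L ` {a. Q a = 0}" "x \<noteq> 0"
  shows "s \<noteq> 0 \<Longrightarrow> M x s = A" "M x 0 + (p - 1) * (p * E) = A"
proof -
  obtain y where y: "Q y = 0" "x = L y" using assms by auto
  hence "y \<notin> R" using assms by (auto simp: R_def)
  hence "p^2 * M x 1 = p ^ e" using M_isotropic[OF y(1)] y(2) by (simp add: card_p flip: p_def)
  hence "p * (p * M x 1) = p * (p * A)" by (simp only: p_pow_e power2_eq_square mult.assoc)
  hence 1: "M x 1 = A" using p_ge by simp
  thus "M x s = A" if "s \<noteq> 0" using M_scale[OF that, of x] by simp
  have *: "m0 + y = A" if "m0 + (l - 1) * A = n0" "n0 + y = l * A" "l > 0" for l m0 n0 y :: nat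
    using that by (cases l) auto
  show "M x 0 + (p - 1) * (p * E) = A"
    by (rule *[OF M_0_p[of x, unfolded 1] N0_val]) (use p_ge in simp)
qed

lemma M_val_anisotropic:
  assumes "x \<in> L ` {a. Q a \<noteq> 0}"
  shows "M x 0 = A" "s \<noteq> 0 \<Longrightarrow> M x s + p * E = A"
proof -
  obtain y where y: "Q y \<noteq> 0" "x = L y" using assms by auto
  have "p^2 * M x 0 = p ^ e" using M_anisotropic[OF y(1)] y(2) by (simp add: card_p flip: p_def)
  hence "p * (p * M x 0) = p * (p * A)" by (simp only: p_pow_e power2_eq_square mult.assoc)
  thus 0: "M x 0 = A" using p_ge by simp
  have *: "m1 + y = A" if "A + (l - 1) * m1 = n0" "n0 + (l - 1) * y = l * A" "l > 1" for l m1 n0 y :: nat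
  proof -
    obtain t where t: "l = Suc t" "t > 0" using \<open>l > 1\<close> by (cases l) auto
    hence "t * (m1 + y) = t * A" using that(1,2) by (simp add: distrib_left)
    thus ?thesis using t by simp
  qed
  have "M x 1 + p * E = A"
    by (rule *[OF M_0_p[of x, unfolded 0] N0_val]) (use p_ge in simp)
  thus "M x s + p * E = A" if "s \<noteq> 0" using M_scale[OF that, of x] by simp
qed

section \<open>Sizes of the classes\<close>

lemma card_range_L: "card (range L) = p ^ (e - 2 * d)"
proof -
  have "card (range L) * p ^ (2 * d) = p ^ e"
    using card_L_image[of UNIV] by (simp add: card_R card_p)
  also have "e = e - 2 * d + 2 * d" using exponents e_eq by simp
  hence "p ^ e = p ^ (e - 2 * d) * p ^ (2 * d)" by (metis power_add)
  finally show ?thesis using p_ge by simp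
qed

lemma card_not_range_L: "card (- range L) = p ^ e - p ^ (e - 2 * d)"
  by (simp add: Compl_eq_Diff_UNIV card_Diff_subset card_range_L card_p)

lemma power_split: "2 * d + j = i \<Longrightarrow> p ^ i = p ^ (2 * d) * p ^ j"
  by (auto simp flip: power_add)

lemma card_L_isotropic:
  "card (L ` {a. Q a = 0}) + (p - 1) * p ^ (m - d - 1) = p ^ (e - 2 * d - 1)"
proof -
  have le: "m \<ge> d + 1" using exponents d_pos by simp
  have "card (L ` {a. Q a = 0}) * p ^ (2 * d) = N0"
    using card_L_image[of "{a. Q a = 0}"] by (simp add: card_R Q_add_R N0_def)
  hence "p ^ (2 * d) * card (L ` {a. Q a = 0}) + (p - 1) * p ^ (m + d - 1) = p ^ (e - 1)"
    using N0_val by (simp only: p_pow_e p_pow_md mult.commute)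
  also have "p ^ (m + d - 1) = p ^ (2 * d) * p ^ (m - d - 1)" by (rule power_split) (use le in simp)
  also have "p ^ (e - 1) = p ^ (2 * d) * p ^ (e - 2 * d - 1)"
    by (rule power_split) (use exponents d_pos e_eq in simp)
  finally have "p ^ (2 * d) * (card (L ` {a. Q a = 0}) + (p - 1) * p ^ (m - d - 1))
      = p ^ (2 * d) * p ^ (e - 2 * d - 1)" by (simp only: distrib_left mult.left_commute)
  thus ?thesis using p_ge by simp
qed

lemma zero_L_isotropic: "0 \<in> L ` {a. Q a = 0}"
  by (rule image_eqI[of _ _ 0]) simp_all

lemma card_L_isotropic_nonzero:
  "card (L ` {a. Q a = 0} - {0}) = p ^ (e - 2 * d - 1) - (p - 1) * p ^ (m - d - 1) - 1"
proof -
  have "card (L ` {a. Q a = 0} - {0}) = card (L ` {a. Q a = 0}) - 1"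
    using zero_L_isotropic by simp
  thus ?thesis using card_L_isotropic by (metis add_diff_cancel_right')
qed

lemma card_L_anisotropic:
  "card (L ` {a. Q a \<noteq> 0}) = (p - 1) * (p ^ (e - 2 * d - 1) + p ^ (m - d - 1))"
proof -
  have le: "m \<ge> d + 1" using exponents d_pos by simp
  have "{a. Q a \<noteq> 0} = UNIV - {a. Q a = 0}" by auto
  hence "card {a. Q a \<noteq> 0} = p ^ e - N0" by (simp add: card_Diff_subset N0_def card_p)
  hence "card (L ` {a. Q a \<noteq> 0}) * p ^ (2 * d) = (p - 1) * N1"
    using card_L_image[of "{a. Q a \<noteq> 0}"] by (simp add: card_R Q_add_R flip: N0_N1_p)
  hence "card (L ` {a. Q a \<noteq> 0}) * p ^ (2 * d) = (p - 1) * (p ^ (e - 1) + p ^ (m + d - 1))"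
    by (simp only: N1_val p_pow_e p_pow_md)
  also have "p ^ (m + d - 1) = p ^ (2 * d) * p ^ (m - d - 1)" by (rule power_split) (use le in simp)
  also have "p ^ (e - 1) = p ^ (2 * d) * p ^ (e - 2 * d - 1)"
    by (rule power_split) (use exponents d_pos e_eq in simp)
  finally have "card (L ` {a. Q a \<noteq> 0}) * p ^ (2 * d)
      = (p - 1) * (p ^ (e - 2 * d - 1) + p ^ (m - d - 1)) * p ^ (2 * d)"
    by (simp only: distrib_left mult_ac)
  thus ?thesis using p_ge by simp
qed

text \<open>\<open>Q\<close> is constant on cosets of \<open>R\<close>, so \<open>Q a\<close>
  depends only on \<open>L a\<close> and the type of \<open>x = L a\<close> is well defined.\<close>

lemma L_image_disjoint: "L ` {a. Q a = 0} \<inter> L ` {a. Q a \<noteq> 0} = {}"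
proof -
  have "Q x = Q y" if "L x = L y" for x y
  proof -
    have "x - y \<in> R" using L_add[of x "- y"] that by (simp add: R_def L_minus)
    thus ?thesis using Q_add_R[of "x - y" y] by simp
  qed
  hence "L x \<noteq> L y" if "Q x = 0" "Q y \<noteq> 0" for x y using that by metis
  thus ?thesis by auto
qed

lemma class_cases:
  obtains "x = 0" | "x \<notin> range L" | "x \<in> L ` {a. Q a = 0} - {0}" | "x \<in> L ` {a. Q a \<noteq> 0}"
proof -
  have "range L = L ` {a. Q a = 0} \<union> L ` {a. Q a \<noteq> 0}" by auto
  thus ?thesis using that by auto
qed

text \<open>Coordinates are indexed by nonzero \<open>y\<close>, whereas \<open>M\<close> includes
  \<open>y = 0\<close> so that translations act. The two counts differ by 1 at \<open>s = 0\<close>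
  only, which is the origin of the \<open>- 1\<close> in the exponents of the unknown indexed by
  \<open>c\<close>.\<close>

definition zeros :: "'a \<Rightarrow> 'p mod_ring \<Rightarrow> nat" where
  "zeros x s = card {y. y \<noteq> 0 \<and> Q y = 0 \<and> T (x * y) = s}"

lemma zeros_nonzero: "s \<noteq> 0 \<Longrightarrow> zeros x s = M x s"
  unfolding zeros_def M_def by (rule arg_cong[where f = card]) auto

lemma zeros_0: "zeros x 0 = M x 0 - 1"
proof -
  have "{y. y \<noteq> 0 \<and> Q y = 0 \<and> T (x * y) = 0} = {y. Q y = 0 \<and> T (x * y) = 0} - {0}" by auto
  thus ?thesis by (simp add: zeros_def M_def)
qed

lemma M_zero: "M 0 s = (if s = 0 then N0 else 0)"
  by (auto simp: M_def N0_def)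

end

section \<open>The code\<close>

locale trace_power_code =
  trace_power_form m \<alpha> e d p b a k TA TP
  for m \<alpha> e d p b a k :: nat and TA :: "'a::{field,finite} itself" and TP :: "'p::prime_card itself" +
  fixes c :: "'p mod_ring" and ds :: "'a list"
  assumes c: "c \<noteq> 0"
    and ds: "distinct ds" "set ds = {y. y \<noteq> 0 \<and> Q y = 0}"
begin

section \<open>Words and their entry counts\<close>

definition n :: nat where "n = length ds"

text \<open>The additive constant is left free because the words with arbitrary \<open>s\<close>
  form the linear code generated by those with \<open>s = c\<close>.\<close>

definition word :: "'a \<Rightarrow> 'p mod_ring \<Rightarrow> 'p mod_ring vec" where
  "word x s = vec_of_list (map (\<lambda>y. T (x * y) + s) ds)"

lemma dim_word [simp]: "dim_vec (word x s) = n"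
  by (simp add: word_def n_def)

lemma word_nth: "j < n \<Longrightarrow> word x s $ j = T (x * ds ! j) + s"
  by (simp add: word_def n_def vec_of_list_index)

lemma card_word_entries:
  "card {j. j < dim_vec (word x s) \<and> word x s $ j = i} = zeros x (i - s)"
proof -
  have "bij_betw (\<lambda>j. ds ! j) {j. j < n \<and> T (x * ds ! j) + s = i}
      {y. y \<noteq> 0 \<and> Q y = 0 \<and> T (x * y) = i - s}"
  proof (rule bij_betw_imageI)
    show "inj_on (\<lambda>j. ds ! j) {j. j < n \<and> T (x * ds ! j) + s = i}"
      using ds(1) by (auto simp: inj_on_def n_def nth_eq_iff_index_eq)
    have "y \<in> set ds \<longleftrightarrow> (\<exists>j<n. ds ! j = y)" for y by (auto simp: in_set_conv_nth n_def)
    hence *: "y \<noteq> 0 \<and> Q y = 0 \<longleftrightarrow> (\<exists>j<n. ds ! j = y)" for y by (simp add: ds(2))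
    have "{y. y \<noteq> 0 \<and> Q y = 0 \<and> T (x * y) = i - s} = {y. (\<exists>j<n. ds ! j = y) \<and> T (x * y) = i - s}"
      using * by blast
    thus "(\<lambda>j. ds ! j) ` {j. j < n \<and> T (x * ds ! j) + s = i}
        = {y. y \<noteq> 0 \<and> Q y = 0 \<and> T (x * y) = i - s}"
      by (auto simp: eq_diff_eq)
  qed
  hence "card {j. j < n \<and> T (x * ds ! j) + s = i} = zeros x (i - s)"
    unfolding zeros_def by (rule bij_betw_same_card)
  moreover have "{j. j < dim_vec (word x s) \<and> word x s $ j = i} = {j. j < n \<and> T (x * ds ! j) + s = i}"
    by (auto simp: word_nth)
  ultimately show ?thesis by simp
qed

lemma n_N0: "n + 1 = N0"
proof -
  have "n = card {y. y \<noteq> 0 \<and> Q y = 0}" using distinct_card[OF ds(1)] ds(2) by (simp add: n_def)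
  also have "{y. y \<noteq> 0 \<and> Q y = 0} = {y. Q y = 0} - {0}" by auto
  also have "card \<dots> = N0 - 1" by (simp add: N0_def)
  finally have "n = N0 - 1" .
  moreover have "{x. Q x = 0} \<noteq> {}" using Q_0 by blast
  hence "N0 > 0" unfolding N0_def by (simp add: card_gt_0_iff)
  ultimately show ?thesis by simp
qed

lemma n_eq: "n + 1 + (p - 1) * (p * E) = p * A"
  using N0_val n_N0 by simp

lemma n_val: "n = p ^ (e - 1) - (p - 1) * p ^ (m + d - 1) - 1"
  unfolding p_pow_e p_pow_md n_eq[symmetric] by simp

lemma zeros_zero: "zeros 0 s = (if s = 0 then n else 0)"
  using zeros_nonzero[of s 0] zeros_0[of 0] M_zero[of s] n_N0 by (auto simp: M_zero)

lemma zeros_not_range: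
  assumes "x \<notin> range L"
  shows "zeros x 0 = A - (p - 1) * E - 1" "s \<noteq> 0 \<Longrightarrow> zeros x s = A - (p - 1) * E"
  using zeros_nonzero[of s x] zeros_0[of x] M_val_not_range[OF assms, of 0] M_val_not_range[OF assms, of s] by auto

lemma zeros_isotropic:
  assumes "x \<in> L ` {a. Q a = 0} - {0}"
  shows "zeros x 0 = A - (p - 1) * (p * E) - 1" "s \<noteq> 0 \<Longrightarrow> zeros x s = A"
  using zeros_nonzero[of s x] zeros_0[of x] M_val_isotropic(1)[of x s] M_val_isotropic(2)[of x] assms by auto

lemma zeros_anisotropic:
  assumes "x \<in> L ` {a. Q a \<noteq> 0}"
  shows "zeros x 0 = A - 1" "s \<noteq> 0 \<Longrightarrow> zeros x s = A - p * E"
  using zeros_nonzero[of s x] zeros_0[of x] M_val_anisotropic(1)[OF assms]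
    M_val_anisotropic(2)[OF assms, of s] by auto

lemma cwe_word: "cwe_monomial (word x c) =
    unknown c ^ zeros x 0 * (\<Prod>i\<in>UNIV - {c}. unknown i ^ zeros x (i - c))"
proof -
  have "cwe_monomial (word x c) = (\<Prod>i\<in>UNIV. unknown i ^ zeros x (i - c))"
    unfolding cwe_monomial_def card_word_entries ..
  also have "\<dots> = unknown c ^ zeros x (c - c) * (\<Prod>i\<in>UNIV - {c}. unknown i ^ zeros x (i - c))"
    by (rule prod.remove) auto
  finally show ?thesis by simp
qed

lemma cwe_word_uniform:
  assumes "zeros x 0 = h" "\<And>s. s \<noteq> 0 \<Longrightarrow> zeros x s = l"
  shows "cwe_monomial (word x c) = unknown c ^ h * (\<Prod>i\<in>UNIV - {c}. unknown i ^ l)"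
  unfolding cwe_word assms(1)
  by (rule arg_cong[where f = "(*) _"], rule prod.cong) (use assms(2) in auto)

text \<open>An entry vanishes where the trace equals \<open>- c\<close>. As this value is not 0,
  weights involve only the counts unaffected by the omission of \<open>y = 0\<close>.\<close>

lemma hamming_weight_word: "hamming_weight (word x c) = n - zeros x (- c)"
proof -
  have "{j. j < dim_vec (word x c) \<and> word x c $ j \<noteq> 0}
      = {j. j < n} - {j. j < dim_vec (word x c) \<and> word x c $ j = 0}" by auto
  hence "hamming_weight (word x c) = card {j. j < n} - card {j. j < dim_vec (word x c) \<and> word x c $ j = 0}"
    unfolding hamming_weight_def by (simp only:) (rule card_Diff_subset; auto)
  thus ?thesis unfolding card_word_entries by simp
qed

lemma sum_classes:
  fixes f :: "'a \<Rightarrow> 'x::comm_monoid_add"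
  shows "sum f UNIV = f 0 + sum f (- range L) + sum f (L ` {a. Q a = 0} - {0}) + sum f (L ` {a. Q a \<noteq> 0})"
proof -
  have r: "range L = L ` {a. Q a = 0} \<union> L ` {a. Q a \<noteq> 0}" by auto
  have "sum f UNIV = sum f (range L \<union> - range L)" by simp
  also have "\<dots> = sum f (range L) + sum f (- range L)" by (rule sum.union_disjoint) auto
  also have "sum f (range L) = sum f (L ` {a. Q a = 0}) + sum f (L ` {a. Q a \<noteq> 0})"
    unfolding r by (rule sum.union_disjoint) (simp_all add: L_image_disjoint)
  also have "sum f (L ` {a. Q a = 0}) = f 0 + sum f (L ` {a. Q a = 0} - {0})"
    by (rule sum.remove) (use zero_L_isotropic in auto)
  finally show ?thesis by (simp add: add_ac)
qed

section \<open>Separation of weights, injectivity and dimension outside the exceptional case\<close>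

context
  assumes large: "\<not> (m = 2 \<and> d = 1)"
begin

text \<open>The claim amounts to \<open>d + 2 \<le> m\<close>. As \<open>m\<close> is a multiple of
  \<open>2 * d\<close>, this can fail only for \<open>d = 1\<close>, \<open>m = 2\<close>, the
  excluded pair.\<close>

lemma pE_le_A: "p * (p * E) \<le> A"
proof -
  have "m + d \<le> e - 2"
  proof (cases "d = 1")
    case True
    have "even m" by (simp add: m_k)
    hence "m \<noteq> 3" by auto
    thus ?thesis using True large exponents e_eq by simp
  next
    case False
    thus ?thesis using d_pos exponents e_eq by simp
  qed
  hence "p ^ (m + d) \<le> p ^ (e - 2)" using p_ge by (intro power_increasing) auto
  thus ?thesis by (simp add: p_pow_md A_def)
qed

lemma E_pos: "E > 0"
  using p_ge by (simp add: E_def)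

text \<open>These are the numbers of zero entries in the words of the four classes, with 0 belonging
  to \<open>x = 0\<close>. Strictness separates the weights, positivity of the least nonzero count
  yields \<open>zeros_pos\<close>, and \<open>A \<le> n\<close> keeps subtraction from
  \<open>n\<close> injective.\<close>

lemma word_counts_order:
  "0 < A - p * E" "A - p * E < A - (p - 1) * E" "A - (p - 1) * E < A" "A \<le> n"
proof -
  have E1: "p * E = (p - 1) * E + E" using p_ge by (simp add: diff_mult_distrib)
  have "3 * (p * E) \<le> p * (p * E)" using p_ge by (rule mult_le_mono1)
  hence A1: "3 * (p * E) \<le> A" using pE_le_A by (rule order.trans)
  have "p * E > 0" using E_pos p_ge by simp
  thus 0: "0 < A - p * E" using A1 by linarith
  show "A - p * E < A - (p - 1) * E" using E1 A1 E_pos by linarith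
  have "(p - 1) * E > 0" using E_pos p_ge by simp
  thus "A - (p - 1) * E < A" using 0 by linarith
  have "(p - 1) * (p * E) + 1 \<le> (p - 1) * A"
  proof -
    have "(p - 1) * (p * E + 1) \<le> (p - 1) * A" using 0 by (intro mult_le_mono2) simp
    moreover have "(p - 1) * (p * E + 1) = (p - 1) * (p * E) + (p - 1)" by (simp add: distrib_left)
    ultimately show ?thesis using p_ge by linarith
  qed
  moreover have "p * A = (p - 1) * A + A" using p_ge by (simp add: diff_mult_distrib)
  ultimately show "A \<le> n" using n_eq by linarith
qed

lemma zeros_pos:
  assumes "x \<noteq> 0" "s \<noteq> 0"
  shows "zeros x s > 0"
proof (cases rule: class_cases[of x])
  case 1
  thus ?thesis using assms by simp
next
  case 2
  show ?thesis unfolding zeros_not_range(2)[OF 2 assms(2)] using word_counts_order by linarith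
next
  case 3
  show ?thesis unfolding zeros_isotropic(2)[OF 3 assms(2)] using word_counts_order by linarith
next
  case 4
  show ?thesis unfolding zeros_anisotropic(2)[OF 4 assms(2)] using word_counts_order by linarith
qed

lemma obtain_trace:
  assumes "x \<noteq> 0" "s \<noteq> 0"
  obtains y where "y \<in> set ds" "T (x * y) = s"
  using zeros_pos[OF assms] unfolding zeros_def ds(2) by (auto simp: card_gt_0_iff)

lemma T_diff: "T (x - y) = T x - T y"
  using T_add[of "x - y" y] by simp

text \<open>If two words agree, the trace against \<open>x - x'\<close> is constant on the defining
  set. A nonzero difference would attain both 1 and -1 there, which are distinct in odd
  characteristic.\<close>

lemma inj_word: "inj (\<lambda>(x, s). word x s)"
proof (rule injI, clarify)
  fix x s x' s' assume eq: "word x s = word x' s'"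
  have T: "T ((x - x') * y) = s' - s" if "y \<in> set ds" for y
  proof -
    obtain j where j: "j < n" "y = ds ! j" using \<open>y \<in> set ds\<close> by (auto simp: in_set_conv_nth n_def)
    have "T (x * y) + s = T (x' * y) + s'" using eq j word_nth by metis
    thus ?thesis by (simp add: left_diff_distrib T_diff algebra_simps)
  qed
  have x: "x = x'"
  proof (rule ccontr)
    assume "x \<noteq> x'"
    hence ne: "x - x' \<noteq> 0" by simp
    obtain y where "y \<in> set ds" "T ((x - x') * y) = 1" using obtain_trace[OF ne, of 1] by auto
    moreover obtain z where "z \<in> set ds" "T ((x - x') * z) = -1"
      using obtain_trace[OF ne, of "-1"] by auto
    ultimately have "(1 :: 'p mod_ring) = -1" using T by metis
    hence "(2 :: 'p mod_ring) = 0" by (metis add.right_inverse one_add_one)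
    thus False using two by simp
  qed
  obtain y where "y \<in> set ds" using obtain_trace[of 1 1] by auto
  hence "s' - s = 0" using T[of y] x T_0 by simp
  thus "x = x' \<and> s = s'" using x by simp
qed

lemma inj_word_c: "inj (\<lambda>x. word x c)"
  using inj_word by (auto simp: inj_def)

lemma weight_multiplicity_words:
  "weight_multiplicity (range (\<lambda>x. word x c)) h = card {x. hamming_weight (word x c) = h}"
proof -
  have "{v \<in> range (\<lambda>x. word x c). hamming_weight v = h}
      = (\<lambda>x. word x c) ` {x. hamming_weight (word x c) = h}" by auto
  thus ?thesis unfolding weight_multiplicity_def
    using card_image[OF inj_on_subset[OF inj_word_c subset_UNIV]] by simp
qed

lemma hamming_weight_cases:
  "hamming_weight (word x c) =
    (if x = 0 then n else if x \<notin> range L then n - (A - (p - 1) * E)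
     else if x \<in> L ` {a. Q a = 0} then n - A else n - (A - p * E))"
proof -
  have c': "- c \<noteq> 0" using c by simp
  have 0: "0 \<in> range L" using L_0 by (metis rangeI)
  show ?thesis
  proof (cases rule: class_cases[of x])
    case 1
    thus ?thesis using c' by (simp add: hamming_weight_word zeros_zero)
  next
    case 2
    hence "x \<noteq> 0" using 0 by auto
    thus ?thesis using 2 by (simp only: hamming_weight_word zeros_not_range(2)[OF 2 c'] if_True if_False not_False_eq_True)
  next
    case 3
    hence "x \<noteq> 0" "x \<in> range L" "x \<in> L ` {a. Q a = 0}" by auto
    thus ?thesis by (simp only: hamming_weight_word zeros_isotropic(2)[OF 3 c'] if_True if_False not_True_eq_False)
  next
    case 4
    hence "x \<in> range L" by auto
    moreover have "x \<notin> L ` {a. Q a = 0}" using 4 L_image_disjoint by blast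
    moreover have "x \<noteq> 0" using calculation(2) zero_L_isotropic by metis
    ultimately show ?thesis
      by (simp only: hamming_weight_word zeros_anisotropic(2)[OF 4 c'] if_True if_False not_True_eq_False)
  qed
qed

lemma weight_classes:
  "{x. hamming_weight (word x c) = n - (A - (p - 1) * E)} = - range L"
  "{x. hamming_weight (word x c) = n - A} = L ` {a. Q a = 0} - {0}"
  "{x. hamming_weight (word x c) = n - (A - p * E)} = L ` {a. Q a \<noteq> 0}"
  "{x. hamming_weight (word x c) = n} = {0}"
  "h \<notin> {n - (A - (p - 1) * E), n - A, n - (A - p * E), n}
    \<Longrightarrow> {x. hamming_weight (word x c) = h} = {}"
proof -
  define u where "u = A - p * E"
  define v where "v = A - (p - 1) * E"
  have "0 < u" "u < v" "v < A" "A \<le> n" unfolding u_def v_def by (fact word_counts_order)+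
  hence ne: "n - v \<noteq> n - A" "n - v \<noteq> n - u" "n - v \<noteq> n" "n - A \<noteq> n - u" "n - A \<noteq> n" "n - u \<noteq> n"
    by linarith+
  note hw = hamming_weight_cases[folded u_def v_def]
  define Z where "Z = L ` {a. Q a = 0}"
  define S where "S = range L"
  have Z: "0 \<in> Z" "Z \<subseteq> S" "L ` {a. Q a \<noteq> 0} = S - Z"
    using zero_L_isotropic L_image_disjoint by (auto simp: Z_def S_def)
  have hw: "hamming_weight (word x c) =
      (if x = 0 then n else if x \<notin> S then n - v else if x \<in> Z then n - A else n - u)" for x
    unfolding Z_def S_def by (rule hw)
  show "{x. hamming_weight (word x c) = n - (A - (p - 1) * E)} = - range L"
    "{x. hamming_weight (word x c) = n - A} = L ` {a. Q a = 0} - {0}"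
    "{x. hamming_weight (word x c) = n - (A - p * E)} = L ` {a. Q a \<noteq> 0}"
    "{x. hamming_weight (word x c) = n} = {0}"
    unfolding u_def[symmetric] v_def[symmetric] Z(3) unfolding Z_def[symmetric] S_def[symmetric]
    using ne ne[symmetric] Z(1,2) by (auto simp: hw split: if_splits)
  show "h \<notin> {n - (A - (p - 1) * E), n - A, n - (A - p * E), n}
    \<Longrightarrow> {x. hamming_weight (word x c) = h} = {}"
    unfolding u_def[symmetric] v_def[symmetric] hw by auto
qed

lemma weight_values:
  "(p - 1) * (p ^ (e - 2) - (p - 1) * p ^ (m + d - 2)) - 1 = n - (A - (p - 1) * E)"
  "(p - 1) * (p ^ (e - 2) - p ^ (m + d - 1)) - 1 = n - A"
  "(p - 1) * p ^ (e - 2) - (p - 2) * p ^ (m + d - 1) - 1 = n - (A - p * E)"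
proof -
  \<comment> \<open>Naming \<open>p - 1\<close>, \<open>p - 2\<close> and the differences turns
    \<open>A\<close> into sums; products such as \<open>t * (p * E)\<close> then serve as atoms for
    linear arithmetic.\<close>
  define t where "t = p - 1"
  define r where "r = p - 2"
  define u where "u = A - t * E"
  define v where "v = A - p * E"
  have A: "A = u + t * E" "A = v + p * E"
    using word_counts_order by (simp_all add: u_def v_def t_def)
  have "p = Suc t" "t = Suc r" using p_ge by (simp_all add: t_def r_def)
  hence t: "p * l = t * l + l" "t * l = r * l + l" for l by (metis mult_Suc add.commute)+
  have n: "n + 1 + t * (p * E) = t * A + A" using n_eq t(1)[of A] by (simp add: t_def)
  have "t * (p * E) = t * (t * E) + t * E" by (simp only: t(1) distrib_left)
  moreover have "t * A = t * u + t * (t * E)" by (simp only: A(1) distrib_left)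
  ultimately have "n + 1 = t * u + u" using n A(1) by linarith
  thus "(p - 1) * (p ^ (e - 2) - (p - 1) * p ^ (m + d - 2)) - 1 = n - (A - (p - 1) * E)"
    unfolding A_def[symmetric] E_def[symmetric] u_def[symmetric] t_def[symmetric] by linarith
  have tA: "t * A = t * v + t * (p * E)" by (simp only: A(2) distrib_left)
  hence n': "n + 1 = t * v + A" using n by linarith
  thus "(p - 1) * (p ^ (e - 2) - p ^ (m + d - 1)) - 1 = n - A"
    unfolding p_pow_md A_def[symmetric] v_def[symmetric] t_def[symmetric] by linarith
  show "(p - 1) * p ^ (e - 2) - (p - 2) * p ^ (m + d - 1) - 1 = n - (A - p * E)"
    unfolding p_pow_md A_def[symmetric] v_def[symmetric] t_def[symmetric] r_def[symmetric]
    using tA t(2)[of "p * E"] n' A(2) by linarith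
qed

lemma CWE_words:
  "CWE (range (\<lambda>x. word x c)) =
    unknown c ^ n
    + of_nat (p ^ e - p ^ (e - 2 * d)) * unknown c ^ (A - (p - 1) * E - 1)
      * (\<Prod>i\<in>UNIV - {c}. unknown i ^ (A - (p - 1) * E))
    + of_nat (p ^ (e - 2 * d - 1) - (p - 1) * p ^ (m - d - 1) - 1)
      * unknown c ^ (A - (p - 1) * (p * E) - 1) * (\<Prod>i\<in>UNIV - {c}. unknown i ^ A)
    + of_nat ((p - 1) * (p ^ (e - 2 * d - 1) + p ^ (m - d - 1)))
      * unknown c ^ (A - 1) * (\<Prod>i\<in>UNIV - {c}. unknown i ^ (A - p * E))"
proof -
  have const: "(\<Sum>x\<in>X. cwe_monomial (word x c)) = of_nat (card X) * unknown c ^ h * (\<Prod>i\<in>UNIV - {c}. unknown i ^ l)"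
    if "\<And>x. x \<in> X \<Longrightarrow> zeros x 0 = h" "\<And>x s. x \<in> X \<Longrightarrow> s \<noteq> 0 \<Longrightarrow> zeros x s = l" for X h l
  proof -
    have "(\<Sum>x\<in>X. cwe_monomial (word x c)) = (\<Sum>x\<in>X. unknown c ^ h * (\<Prod>i\<in>UNIV - {c}. unknown i ^ l))"
      by (rule sum.cong[OF refl], rule cwe_word_uniform) (use that in auto)
    thus ?thesis by (simp only: sum_constant mult.assoc)
  qed
  have "CWE (range (\<lambda>x. word x c)) = (\<Sum>x\<in>UNIV. cwe_monomial (word x c))"
    unfolding CWE_def by (rule sum.reindex[OF inj_word_c, unfolded o_def])
  also have "\<dots> = cwe_monomial (word 0 c) + (\<Sum>x\<in>- range L. cwe_monomial (word x c))
      + (\<Sum>x\<in>L ` {a. Q a = 0} - {0}. cwe_monomial (word x c))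
      + (\<Sum>x\<in>L ` {a. Q a \<noteq> 0}. cwe_monomial (word x c))"
    by (rule sum_classes)
  also have "cwe_monomial (word 0 c) = unknown c ^ n * (\<Prod>i\<in>UNIV - {c}. unknown i ^ 0)"
    by (rule cwe_word_uniform) (simp_all add: zeros_zero)
  also have "\<dots> = unknown c ^ n" by simp
  also have "(\<Sum>x\<in>- range L. cwe_monomial (word x c)) =
      of_nat (card (- range L)) * unknown c ^ (A - (p - 1) * E - 1)
      * (\<Prod>i\<in>UNIV - {c}. unknown i ^ (A - (p - 1) * E))"
    by (rule const) (simp_all add: zeros_not_range del: One_nat_def)
  also have "(\<Sum>x\<in>L ` {a. Q a = 0} - {0}. cwe_monomial (word x c)) =
      of_nat (card (L ` {a. Q a = 0} - {0})) * unknown c ^ (A - (p - 1) * (p * E) - 1)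
      * (\<Prod>i\<in>UNIV - {c}. unknown i ^ A)"
    by (rule const, erule zeros_isotropic(1), erule zeros_isotropic(2))
  also have "(\<Sum>x\<in>L ` {a. Q a \<noteq> 0}. cwe_monomial (word x c)) =
      of_nat (card (L ` {a. Q a \<noteq> 0})) * unknown c ^ (A - 1)
      * (\<Prod>i\<in>UNIV - {c}. unknown i ^ (A - p * E))"
    by (rule const, erule zeros_anisotropic(1), erule zeros_anisotropic(2))
  finally show ?thesis by (simp only: card_not_range_L card_L_isotropic_nonzero card_L_anisotropic)
qed

text \<open>The words with free additive constant form a subspace. They lie in the span because
  \<open>word 0 c\<close> is the nonzero constant word, so adding a multiple of it to
  \<open>word x c\<close> changes the constant at will. Injectivity gives \<open>p ^ e * p\<close>
  words, hence the dimension \<open>e + 1\<close>.\<close>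

lemma linear_code_words: "linear_code n (e + 1) (generated_code n (range (\<lambda>x. word x c)))"
proof -
  interpret V: vec_space "TYPE('p mod_ring)" n .
  define W where "W = range (\<lambda>(x, s). word x s)"
  define C where "C = range (\<lambda>x. word x c)"
  have carrier: "word x s \<in> carrier_vec n" for x s by (rule carrier_vecI) simp
  have add: "word x s + word x' s' = word (x + x') (s + s')" for x s x' s'
    by (rule eq_vecI) (auto simp: word_nth distrib_right T_add)
  have smult: "l \<cdot>\<^sub>v word x s = word (emb l * x) (l * s)" for l x s
    by (rule eq_vecI) (auto simp: word_nth distrib_left T_scale mult.assoc)
  have zero: "0\<^sub>v n = word 0 0"
    by (rule eq_vecI) (auto simp: word_nth)
  have C: "C \<subseteq> carrier_vec n" using carrier by (auto simp: C_def)
  have wI: "word x s \<in> W" for x s unfolding W_def by (rule image_eqI[of _ _ "(x, s)"]) auto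
  have WE: "\<exists>x s. v = word x s" if "v \<in> W" for v using that by (auto simp: W_def)
  have sub: "submodule class_ring W (module_vec TYPE('p mod_ring) n)"
    by unfold_locales (auto simp: module_vec_simps carrier add smult zero wI dest!: WE)
  have "V.span C = W"
  proof
    show "V.span C \<subseteq> W"
      by (rule V.span_is_subset[OF _ sub]) (auto simp: C_def wI)
    have mem: "word x c \<in> V.span C" for x
      by (rule V.span_mem) (use C in \<open>auto simp: C_def\<close>)
    have "word x s \<in> V.span C" for x s
    proof -
      have "word x s = word x c + ((s - c) / c) \<cdot>\<^sub>v word 0 c"
        using c by (simp add: add smult)
      thus ?thesis using V.span_add1[OF C mem V.smult_in_span[OF C mem]] by simp
    qed
    thus "W \<subseteq> V.span C" by (auto dest!: WE)
  qed
  moreover have "linear_code n (e + 1) (V.span C)"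
  proof (rule linear_codeI)
    show "VectorSpace.subspace class_ring (V.span C) (module_vec TYPE('p mod_ring) n)"
      by (rule V.span_is_subspace[OF C])
    have "card W = card (UNIV :: ('a \<times> 'p mod_ring) set)"
      unfolding W_def by (rule card_image[OF inj_word])
    also have "\<dots> = CARD('a) * CARD('p mod_ring)" by (simp add: card_prod)
    also have "\<dots> = CARD('p mod_ring) ^ (e + 1)" by (simp add: card_p p_def)
    finally show "card (V.span C) = CARD('p mod_ring) ^ (e + 1)" by (simp only: \<open>V.span C = W\<close>)
  qed
  ultimately show ?thesis by (simp add: generated_code_def C_def)
qed

end

end

theorem theorem2p3:
  fixes p m \<alpha> e d :: nat
    and c :: "'p::prime_card mod_ring"
    and ds :: "'a::{field,finite} list"
    and C :: "'p mod_ring vec set"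
  assumes p: "p = CARD('p)" "odd p"
    and m: "m > 0"
    and \<alpha>: "\<alpha> > 0"
    and e: "e = 2 * m"
    and q: "CARD('a) = p ^ e"
    and d: "d = gcd \<alpha> e"
    and md: "d dvd m" "even (m div d)"
    and c: "c \<noteq> 0"
    and D: "distinct ds"
           "set ds = {x. x \<noteq> 0 \<and> (field_trace e (x ^ (p ^ \<alpha> + 1)) :: 'p mod_ring) = 0}"
    and C: "C = range (\<lambda>x. vec_of_list (map (\<lambda>y. field_trace e (x * y) + c) ds))"
  shows "length ds = p ^ (e - 1) - (p - 1) * p ^ (m + d - 1) - 1 \<and>
    (\<not> (m = 2 \<and> d = 1) \<longrightarrow>
      linear_code (length ds) (e + 1) (generated_code (length ds) C) \<and>
      weight_multiplicity C ((p - 1) * (p ^ (e - 2) - (p - 1) * p ^ (m + d - 2)) - 1)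
        = p ^ e - p ^ (e - 2 * d) \<and>
      weight_multiplicity C ((p - 1) * (p ^ (e - 2) - p ^ (m + d - 1)) - 1)
        = p ^ (e - 2 * d - 1) - (p - 1) * p ^ (m - d - 1) - 1 \<and>
      weight_multiplicity C ((p - 1) * p ^ (e - 2) - (p - 2) * p ^ (m + d - 1) - 1)
        = (p - 1) * (p ^ (e - 2 * d - 1) + p ^ (m - d - 1)) \<and>
      weight_multiplicity C (p ^ (e - 1) - (p - 1) * p ^ (m + d - 1) - 1) = 1 \<and>
      (\<forall>h. h \<notin> {(p - 1) * (p ^ (e - 2) - (p - 1) * p ^ (m + d - 2)) - 1,
                 (p - 1) * (p ^ (e - 2) - p ^ (m + d - 1)) - 1,
                 (p - 1) * p ^ (e - 2) - (p - 2) * p ^ (m + d - 1) - 1,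
                 p ^ (e - 1) - (p - 1) * p ^ (m + d - 1) - 1}
         \<longrightarrow> weight_multiplicity C h = 0) \<and>
      CWE C =
        unknown c ^ (p ^ (e - 1) - (p - 1) * p ^ (m + d - 1) - 1)
        + of_nat (p ^ e - p ^ (e - 2 * d))
          * unknown c ^ (p ^ (e - 2) - (p - 1) * p ^ (m + d - 2) - 1)
          * (\<Prod>i\<in>UNIV - {c}. unknown i ^ (p ^ (e - 2) - (p - 1) * p ^ (m + d - 2)))
        + of_nat (p ^ (e - 2 * d - 1) - (p - 1) * p ^ (m - d - 1) - 1)
          * unknown c ^ (p ^ (e - 2) - (p - 1) * p ^ (m + d - 1) - 1)
          * (\<Prod>i\<in>UNIV - {c}. unknown i ^ (p ^ (e - 2)))
        + of_nat ((p - 1) * (p ^ (e - 2 * d - 1) + p ^ (m - d - 1)))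
          * unknown c ^ (p ^ (e - 2) - 1)
          * (\<Prod>i\<in>UNIV - {c}. unknown i ^ (p ^ (e - 2) - p ^ (m + d - 1))))"
proof -
  define a where "a = \<alpha> div d"
  define k where "k = m div d div 2"
  have d_pos: "d > 0" using \<alpha> d by simp
  have \<alpha>_a: "\<alpha> = d * a" unfolding a_def by (rule dvd_mult_div_cancel[symmetric]) (simp add: d)
  have m_k: "m = d * (2 * k)" using md by (simp add: k_def)
  have gcd_a: "gcd a (4 * k) = 1"
  proof -
    have "e = d * (4 * k)" unfolding e by (subst m_k) simp
    hence "gcd (d * a) (d * (4 * k)) = d" using d \<alpha>_a by metis
    hence "d * gcd a (4 * k) = d" by (simp only: gcd_mult_distrib_nat)
    thus ?thesis using d_pos by simp
  qed
  have pos: "a > 0" "k > 0" using \<alpha> \<alpha>_a m m_k by (auto intro: Nat.gr0I)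
  interpret F: trace_power_form m \<alpha> e d p "p ^ d" a k "TYPE('a)" "TYPE('p)"
    by unfold_locales (fact p q d_pos pos \<alpha>_a m_k e gcd_a refl)+
  interpret W: trace_power_code m \<alpha> e d p "p ^ d" a k "TYPE('a)" "TYPE('p)" c ds
    by unfold_locales (use c D in \<open>simp_all add: F.Q_def F.T_def\<close>)
  have n: "length ds = W.n" by (simp only: W.n_def)
  have Cw: "C = range (\<lambda>x. W.word x c)" unfolding C W.word_def F.T_def ..
  show ?thesis
  proof (intro conjI impI)
    show "length ds = p ^ (e - 1) - (p - 1) * p ^ (m + d - 1) - 1"
      unfolding n by (rule W.n_val)
  next
    assume large: "\<not> (m = 2 \<and> d = 1)"
    note mult = W.weight_multiplicity_words[OF large, folded Cw]
    note cl = W.weight_classes[OF large]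
    note val = W.weight_values[OF large]
    note nv = W.n_val
    show "linear_code (length ds) (e + 1) (generated_code (length ds) C)"
      unfolding n Cw by (rule W.linear_code_words[OF large])
    show "weight_multiplicity C ((p - 1) * (p ^ (e - 2) - (p - 1) * p ^ (m + d - 2)) - 1)
        = p ^ e - p ^ (e - 2 * d)"
      unfolding val mult cl by (rule F.card_not_range_L)
    show "weight_multiplicity C ((p - 1) * (p ^ (e - 2) - p ^ (m + d - 1)) - 1)
        = p ^ (e - 2 * d - 1) - (p - 1) * p ^ (m - d - 1) - 1"
      unfolding val mult cl by (rule F.card_L_isotropic_nonzero)
    show "weight_multiplicity C ((p - 1) * p ^ (e - 2) - (p - 2) * p ^ (m + d - 1) - 1)
        = (p - 1) * (p ^ (e - 2 * d - 1) + p ^ (m - d - 1))"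
      unfolding val mult cl by (rule F.card_L_anisotropic)
    show "weight_multiplicity C (p ^ (e - 1) - (p - 1) * p ^ (m + d - 1) - 1) = 1"
      unfolding nv[symmetric] mult cl by simp
    show "\<forall>h. h \<notin> {(p - 1) * (p ^ (e - 2) - (p - 1) * p ^ (m + d - 2)) - 1,
                 (p - 1) * (p ^ (e - 2) - p ^ (m + d - 1)) - 1,
                 (p - 1) * p ^ (e - 2) - (p - 2) * p ^ (m + d - 1) - 1,
                 p ^ (e - 1) - (p - 1) * p ^ (m + d - 1) - 1}
         \<longrightarrow> weight_multiplicity C h = 0"
      unfolding val nv[symmetric] mult using cl(5) by (metis card.empty)
    show "CWE C =
        unknown c ^ (p ^ (e - 1) - (p - 1) * p ^ (m + d - 1) - 1)
        + of_nat (p ^ e - p ^ (e - 2 * d))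
          * unknown c ^ (p ^ (e - 2) - (p - 1) * p ^ (m + d - 2) - 1)
          * (\<Prod>i\<in>UNIV - {c}. unknown i ^ (p ^ (e - 2) - (p - 1) * p ^ (m + d - 2)))
        + of_nat (p ^ (e - 2 * d - 1) - (p - 1) * p ^ (m - d - 1) - 1)
          * unknown c ^ (p ^ (e - 2) - (p - 1) * p ^ (m + d - 1) - 1)
          * (\<Prod>i\<in>UNIV - {c}. unknown i ^ (p ^ (e - 2)))
        + of_nat ((p - 1) * (p ^ (e - 2 * d - 1) + p ^ (m - d - 1)))
          * unknown c ^ (p ^ (e - 2) - 1)
          * (\<Prod>i\<in>UNIV - {c}. unknown i ^ (p ^ (e - 2) - p ^ (m + d - 1)))"
      unfolding Cw W.CWE_words[OF large] nv F.p_pow_md F.A_def F.E_def ..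
  qed
qed

end
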